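(* Let $\Lambda$ be a set and $\mathfrak g=\mathrm F^{\mathrm{Lie}}_{\mathbb Q}[X_\lambda:\lambda\in\Lambda]$ the free Lie algebra over $\mathbb Q$ on the generators $X_\lambda$. Then the Poincaré–Birkhoff–Witt theorem holds for $\mathfrak g$: for every $n\ge0$ the natural map $\boldsymbol m^{(n)}:\bigodot^n\mathfrak g\to\mathcal U^n\mathfrak g/\mathcal U^{n-1}\mathfrak g$ is an isomorphism of $\mathbb Q$-vector spaces.
   Context: All tensor products are over $\mathbb Q$. The universal enveloping algebra $\mathcal U\mathfrak g$ is the tensor algebra $\bigotimes\mathfrak g=\bigoplus_{n\ge0}\mathfrak g^{\otimes n}$ modulo the two-sided ideal generated by the elements $X\otimes Y-Y\otimes X-[X,Y]$ ($X,Y\in\mathfrak g$); $\boldsymbol m:\bigotimes\mathfrak g\to\mathcal U\mathfrak g$ is the quotient map. $\mathcal U^n\mathfrak g=\boldsymbol m\bigl(\bigoplus_{j\le n}\mathfrak g^{\otimes j}\bigr)$, with $\mathcal U^{-1}\mathfrak g=0$. $\bigodot^n\mathfrak g$ is the $n$-th symmetric power of $\mathfrak g$ (quotient of $\mathfrak g^{\otimes n}$ by permutations). The surjection $\boldsymbol m^{(n)}$ sends $x_1\odot\cdots\odot x_n$ to the class of $\boldsymbol m(x_1\otimes\cdots\otimes x_n)$. *)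

theory Defs
  imports Complex_Main "HOL-Algebra.Module" "HOL-Algebra.QuotRing" "HOL-Library.Multiset" "HOL-Library.Poly_Mapping"
begin

text \<open>
  Vector spaces and algebras over the rationals are records of type \<open>(rat, 'a) module\<close>; for bare
  vector spaces the fields \<open>mult\<close> and \<open>one\<close> carry no meaning.  A Lie algebra is such a record whose
  \<open>mult\<close> field is the bracket, so that \<open>X \<otimes>\<^bsub>g\<^esub> Y\<close> stands for \<open>[X, Y]\<close> (and \<open>one\<close> is meaningless).
\<close>

definition rat_ring :: "rat ring" where
  "rat_ring = \<lparr>carrier = UNIV, monoid.mult = (*), one = 1, zero = 0, add = (+)\<rparr>"

definition lin_span :: "(rat, 'a, 'm) module_scheme \<Rightarrow> 'a set \<Rightarrow> 'a set" where
  "lin_span M S = \<Inter>{H. submodule H rat_ring M \<and> S \<subseteq> H}"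

text \<open>
  The quotient \<open>M / H\<close>, with cosets as elements.  The scalar action is \<open>c (H + x) = H + c x\<close>; adding
  \<open>H\<close> is needed because for \<open>c = 0\<close> the elementwise multiple of a coset is just \<open>{0}\<close>.
  If \<open>H\<close> is a two-sided ideal of an algebra \<open>M\<close>, this is the quotient algebra.
\<close>
definition quot_mod :: "(rat, 'a, 'm) module_scheme \<Rightarrow> 'a set \<Rightarrow> (rat, 'a set) module" where
  "quot_mod M H =
     \<lparr>carrier = carrier (M Quot H), monoid.mult = monoid.mult (M Quot H), one = one (M Quot H),
      zero = zero (M Quot H), add = add (M Quot H),
      smult = (\<lambda>c C. H <+>\<^bsub>M\<^esub> (\<lambda>x. c \<odot>\<^bsub>M\<^esub> x) ` C)\<rparr>"

definition lin_iso ::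
    "(rat, 'a, 'm) module_scheme \<Rightarrow> (rat, 'b, 'n) module_scheme \<Rightarrow> ('a \<Rightarrow> 'b) set" where
  "lin_iso M N = {f. bij_betw f (carrier M) (carrier N) \<and>
     (\<forall>x\<in>carrier M. \<forall>y\<in>carrier M. f (x \<oplus>\<^bsub>M\<^esub> y) = f x \<oplus>\<^bsub>N\<^esub> f y) \<and>
     (\<forall>c. \<forall>x\<in>carrier M. f (c \<odot>\<^bsub>M\<^esub> x) = c \<odot>\<^bsub>N\<^esub> f x)}"

definition free_mod :: "'x set \<Rightarrow> (rat, 'x \<Rightarrow>\<^sub>0 rat) module" where
  "free_mod S =
     \<lparr>carrier = {p. Poly_Mapping.keys p \<subseteq> S}, monoid.mult = undefined, one = undefined,
      zero = 0, add = (+), smult = (\<lambda>c. Poly_Mapping.map ((*) c))\<rparr>"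

definition bilin_ext ::
    "('x \<Rightarrow> 'y \<Rightarrow> 'z) \<Rightarrow> ('x \<Rightarrow>\<^sub>0 rat) \<Rightarrow> ('y \<Rightarrow>\<^sub>0 rat) \<Rightarrow> ('z \<Rightarrow>\<^sub>0 rat)" where
  "bilin_ext f p q = (\<Sum>a\<in>Poly_Mapping.keys p. \<Sum>b\<in>Poly_Mapping.keys q.
     Poly_Mapping.single (f a b) (Poly_Mapping.lookup p a * Poly_Mapping.lookup q b))"

text \<open>
  The free nonassociative algebra on \<open>\<Lambda>\<close> has as basis the nonassociative monomials (binary trees
  with leaves in \<open>\<Lambda>\<close>).  The free Lie algebra is its quotient by the two-sided ideal generated by
  the elements \<open>[p, p]\<close> and the Jacobi expressions.
\<close>

datatype 'l magma = Gen 'l | Br "'l magma" "'l magma"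

definition free_nonassoc :: "'l set \<Rightarrow> (rat, 'l magma \<Rightarrow>\<^sub>0 rat) module" where
  "free_nonassoc \<Lambda> = (free_mod {t. set_magma t \<subseteq> \<Lambda>})\<lparr>monoid.mult := bilin_ext Br\<rparr>"

inductive_set lie_ideal :: "'l set \<Rightarrow> ('l magma \<Rightarrow>\<^sub>0 rat) set" for \<Lambda> where
  alternating: "p \<in> carrier (free_nonassoc \<Lambda>) \<Longrightarrow> p \<otimes>\<^bsub>free_nonassoc \<Lambda>\<^esub> p \<in> lie_ideal \<Lambda>"
| jacobi: "\<lbrakk>p \<in> carrier (free_nonassoc \<Lambda>); q \<in> carrier (free_nonassoc \<Lambda>);
     r \<in> carrier (free_nonassoc \<Lambda>)\<rbrakk> \<Longrightarrow>
     p \<otimes>\<^bsub>free_nonassoc \<Lambda>\<^esub> (q \<otimes>\<^bsub>free_nonassoc \<Lambda>\<^esub> r)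
     + q \<otimes>\<^bsub>free_nonassoc \<Lambda>\<^esub> (r \<otimes>\<^bsub>free_nonassoc \<Lambda>\<^esub> p)
     + r \<otimes>\<^bsub>free_nonassoc \<Lambda>\<^esub> (p \<otimes>\<^bsub>free_nonassoc \<Lambda>\<^esub> q) \<in> lie_ideal \<Lambda>"
| zero: "0 \<in> lie_ideal \<Lambda>"
| add: "\<lbrakk>u \<in> lie_ideal \<Lambda>; v \<in> lie_ideal \<Lambda>\<rbrakk> \<Longrightarrow> u + v \<in> lie_ideal \<Lambda>"
| smult: "u \<in> lie_ideal \<Lambda> \<Longrightarrow> c \<odot>\<^bsub>free_nonassoc \<Lambda>\<^esub> u \<in> lie_ideal \<Lambda>"
| mult_left: "\<lbrakk>u \<in> lie_ideal \<Lambda>; p \<in> carrier (free_nonassoc \<Lambda>)\<rbrakk> \<Longrightarrow>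
     p \<otimes>\<^bsub>free_nonassoc \<Lambda>\<^esub> u \<in> lie_ideal \<Lambda>"
| mult_right: "\<lbrakk>u \<in> lie_ideal \<Lambda>; p \<in> carrier (free_nonassoc \<Lambda>)\<rbrakk> \<Longrightarrow>
     u \<otimes>\<^bsub>free_nonassoc \<Lambda>\<^esub> p \<in> lie_ideal \<Lambda>"

definition free_lie :: "'l set \<Rightarrow> (rat, ('l magma \<Rightarrow>\<^sub>0 rat) set) module" where
  "free_lie \<Lambda> = quot_mod (free_nonassoc \<Lambda>) (lie_ideal \<Lambda>)"

text \<open>
  The word \<open>[x\<^sub>1, \<dots>, x\<^sub>n]\<close> stands for the formal tensor \<open>x\<^sub>1 \<otimes> \<dots> \<otimes> x\<^sub>n\<close>; the \<open>n\<close>-th tensor power is the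
  space of formal linear combinations of words of length \<open>n\<close> modulo multilinearity.
\<close>

definition words :: "(rat, 'a, 'm) module_scheme \<Rightarrow> nat \<Rightarrow> 'a list set" where
  "words g n = {xs. length xs = n \<and> set xs \<subseteq> carrier g}"

definition multilin_rel :: "(rat, 'a, 'm) module_scheme \<Rightarrow> nat \<Rightarrow> ('a list \<Rightarrow>\<^sub>0 rat) set" where
  "multilin_rel g n = lin_span (free_mod (words g n))
     ({Poly_Mapping.single (us @ (x \<oplus>\<^bsub>g\<^esub> y) # vs) 1
         - Poly_Mapping.single (us @ x # vs) 1 - Poly_Mapping.single (us @ y # vs) 1 | us x y vs.
         us @ x # vs \<in> words g n \<and> us @ y # vs \<in> words g n} \<union>
      {Poly_Mapping.single (us @ (c \<odot>\<^bsub>g\<^esub> x) # vs) 1 - Poly_Mapping.single (us @ x # vs) c | us c x vs.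
         us @ x # vs \<in> words g n})"

definition tensor_power ::
    "(rat, 'a, 'm) module_scheme \<Rightarrow> nat \<Rightarrow> (rat, ('a list \<Rightarrow>\<^sub>0 rat) set) module" where
  "tensor_power g n = quot_mod (free_mod (words g n)) (multilin_rel g n)"

definition pure_tensor :: "(rat, 'a, 'm) module_scheme \<Rightarrow> 'a list \<Rightarrow> ('a list \<Rightarrow>\<^sub>0 rat) set" where
  "pure_tensor g xs = multilin_rel g (length xs)
     +>\<^bsub>free_mod (words g (length xs))\<^esub> Poly_Mapping.single xs 1"

text \<open>
  The concatenation product of the \<open>i\<close>-th and the \<open>j\<close>-th tensor power into the \<open>(i + j)\<close>-th, written
  on cosets in the same way as \<^const>\<open>rcoset_mult\<close>.
\<close>
definition tensor_mult :: "(rat, 'a, 'm) module_scheme \<Rightarrow> nat \<Rightarrow> nat \<Rightarrow>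
    ('a list \<Rightarrow>\<^sub>0 rat) set \<Rightarrow> ('a list \<Rightarrow>\<^sub>0 rat) set \<Rightarrow> ('a list \<Rightarrow>\<^sub>0 rat) set" where
  "tensor_mult g i j C D =
     (\<Union>p\<in>C. \<Union>q\<in>D. multilin_rel g (i + j) +>\<^bsub>free_mod (words g (i + j))\<^esub> bilin_ext (@) p q)"

definition in_degree ::
    "(rat, 'a, 'm) module_scheme \<Rightarrow> nat \<Rightarrow> ('a list \<Rightarrow>\<^sub>0 rat) set \<Rightarrow> nat \<Rightarrow> ('a list \<Rightarrow>\<^sub>0 rat) set" where
  "in_degree g n C = (\<lambda>k. if k = n then C else \<zero>\<^bsub>tensor_power g k\<^esub>)"

text \<open>The direct sum of all tensor powers, an element being the family of its components.\<close>
definition tensor_algebra ::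
    "(rat, 'a, 'm) module_scheme \<Rightarrow> (rat, nat \<Rightarrow> ('a list \<Rightarrow>\<^sub>0 rat) set) module" where
  "tensor_algebra g =
     \<lparr>carrier = {u. (\<forall>n. u n \<in> carrier (tensor_power g n)) \<and>
                    finite {n. u n \<noteq> \<zero>\<^bsub>tensor_power g n\<^esub>}},
      monoid.mult = (\<lambda>u v n. \<Oplus>\<^bsub>tensor_power g n\<^esub>i\<in>{..n}. tensor_mult g i (n - i) (u i) (v (n - i))),
      one = in_degree g 0 (pure_tensor g []),
      zero = (\<lambda>n. \<zero>\<^bsub>tensor_power g n\<^esub>),
      add = (\<lambda>u v n. u n \<oplus>\<^bsub>tensor_power g n\<^esub> v n),
      smult = (\<lambda>c u n. c \<odot>\<^bsub>tensor_power g n\<^esub> u n)\<rparr>"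

definition tensor_incl ::
    "(rat, 'a, 'm) module_scheme \<Rightarrow> 'a \<Rightarrow> nat \<Rightarrow> ('a list \<Rightarrow>\<^sub>0 rat) set" where
  "tensor_incl g x = in_degree g 1 (pure_tensor g [x])"

definition uea_ideal ::
    "(rat, 'a, 'm) module_scheme \<Rightarrow> (nat \<Rightarrow> ('a list \<Rightarrow>\<^sub>0 rat) set) set" where
  "uea_ideal g = genideal (tensor_algebra g)
     {(tensor_incl g x \<otimes>\<^bsub>tensor_algebra g\<^esub> tensor_incl g y)
        \<ominus>\<^bsub>tensor_algebra g\<^esub> (tensor_incl g y \<otimes>\<^bsub>tensor_algebra g\<^esub> tensor_incl g x)
        \<ominus>\<^bsub>tensor_algebra g\<^esub> tensor_incl g (x \<otimes>\<^bsub>g\<^esub> y) | x y.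
        x \<in> carrier g \<and> y \<in> carrier g}"

definition uea ::
    "(rat, 'a, 'm) module_scheme \<Rightarrow> (rat, (nat \<Rightarrow> ('a list \<Rightarrow>\<^sub>0 rat) set) set) module" where
  "uea g = quot_mod (tensor_algebra g) (uea_ideal g)"

definition uea_proj :: "(rat, 'a, 'm) module_scheme \<Rightarrow>
    (nat \<Rightarrow> ('a list \<Rightarrow>\<^sub>0 rat) set) \<Rightarrow> (nat \<Rightarrow> ('a list \<Rightarrow>\<^sub>0 rat) set) set" where
  "uea_proj g u = uea_ideal g +>\<^bsub>tensor_algebra g\<^esub> u"

text \<open>The index is an integer; for \<open>k = - 1\<close> only \<open>u = 0\<close> qualifies, so this is the zero subspace.\<close>
definition uea_filt ::
    "(rat, 'a, 'm) module_scheme \<Rightarrow> int \<Rightarrow> (nat \<Rightarrow> ('a list \<Rightarrow>\<^sub>0 rat) set) set set" where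
  "uea_filt g k = uea_proj g `
     {u \<in> carrier (tensor_algebra g). \<forall>j. int j > k \<longrightarrow> u j = \<zero>\<^bsub>tensor_power g j\<^esub>}"

definition uea_gr ::
    "(rat, 'a, 'm) module_scheme \<Rightarrow> nat \<Rightarrow> (rat, (nat \<Rightarrow> ('a list \<Rightarrow>\<^sub>0 rat) set) set set) module" where
  "uea_gr g n = quot_mod ((uea g)\<lparr>carrier := uea_filt g (int n)\<rparr>) (uea_filt g (int n - 1))"

definition sym_rel :: "(rat, 'a, 'm) module_scheme \<Rightarrow> nat \<Rightarrow> ('a list \<Rightarrow>\<^sub>0 rat) set set" where
  "sym_rel g n = lin_span (tensor_power g n)
     {pure_tensor g xs \<ominus>\<^bsub>tensor_power g n\<^esub> pure_tensor g ys | xs ys.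
        xs \<in> words g n \<and> ys \<in> words g n \<and> mset xs = mset ys}"

definition sym_power ::
    "(rat, 'a, 'm) module_scheme \<Rightarrow> nat \<Rightarrow> (rat, ('a list \<Rightarrow>\<^sub>0 rat) set set) module" where
  "sym_power g n = quot_mod (tensor_power g n) (sym_rel g n)"

text \<open>
  The map induced on \<open>sym_power g n\<close> by sending a tensor \<open>C\<close> of degree \<open>n\<close> to the class of its
  image in \<open>uea g\<close> modulo \<open>uea_filt g (n - 1)\<close>: all members \<open>C\<close> of a coset \<open>S\<close> have the same image, and that is the
  value at \<open>S\<close>.
\<close>
definition pbw_map :: "(rat, 'a, 'm) module_scheme \<Rightarrow> nat \<Rightarrow>
    ('a list \<Rightarrow>\<^sub>0 rat) set set \<Rightarrow> (nat \<Rightarrow> ('a list \<Rightarrow>\<^sub>0 rat) set) set set" where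
  "pbw_map g n S = the_elem
     ((\<lambda>C. uea_filt g (int n - 1) +>\<^bsub>uea g\<^esub> uea_proj g (in_degree g n C)) ` S)"

end

theory Submission
  imports Defs "HOL-Library.Product_Plus"
begin

text \<open>
  Let \<open>F\<close> be the free associative algebra on \<open>\<Lambda>\<close>.  Turning brackets into commutators gives \<open>\<iota> : g \<rightarrow> F\<close>, and by
  Dynkin's argument right-normed bracketing of words, divided by the degree, is a linear map \<open>\<pi> : F \<rightarrow> g\<close>
  with \<open>\<pi> \<circ> \<iota> = id\<close> and \<open>\<pi> 1 = 0\<close>.  Elements of \<open>\<iota> g\<close> are primitive for the unshuffle coproduct, so the \<open>n\<close>-fold
  coproduct of \<open>\<iota> x\<^sub>1 \<cdots> \<iota> x\<^sub>m\<close> distributes the factors over \<open>n\<close> places in all possible ways.  Applying \<open>\<pi>\<close> in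
  each place kills every distribution with an empty place: nothing is left if \<open>m < n\<close>, and \<open>n!\<close> times
  \<open>x\<^sub>1 \<odot> \<cdots> \<odot> x\<^sub>n\<close> is left if \<open>m = n\<close>.  Dividing by \<open>n!\<close> yields a left inverse of the PBW map.  No basis of \<open>g\<close>
  is needed, but characteristic \<open>0\<close> is used twice.
\<close>

section \<open>Linear algebra of finitely supported functions\<close>

text \<open>Injectivity is the difficulty: elements of the quotient U g can be told apart only by
  maps out of it. The map used here is the homomorphism U g -> F extending \<iota>, whose target has
  the words as a basis and is therefore open to calculation. A second obstacle is that tensor and
  symmetric powers consist of cosets of formal combinations of words over g. Calculations are done
  on the formal combinations, where a formula for each basis word suffices, and equality in the
  symmetric algebra becomes congruence modulo an ideal \<open>K\<close> of relations. The congruence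
  is unavoidable: the formal word [x] does not depend linearly on x, so a left inverse that applies
  \<pi> to basis words gives the expected answer only modulo \<open>K\<close>. The two divisions
  have separate origins. The degree in \<pi> counts how often right-normed bracketing reproduces a
  Lie monomial; n! counts the bijections between n factors and n places.\<close>

text \<open>
  With concatenation as addition of words, the convolution product that \<^typ>\<open>'a \<Rightarrow>\<^sub>0 'b\<close> carries in the
  library is the product of the free associative algebra.
\<close>
instantiation list :: (type) monoid_add
begin
definition zero_list :: "'a list" where "zero_list = []"
definition plus_list :: "'a list \<Rightarrow> 'a list \<Rightarrow> 'a list" where "plus_list = (@)"
instance by standard (simp_all add: zero_list_def plus_list_def)
end

text \<open>Spelled as in \<open>free_mod\<close>, so that scalar multiplication there unfolds to
  it.\<close>

abbreviation pscale :: "rat \<Rightarrow> ('a \<Rightarrow>\<^sub>0 rat) \<Rightarrow> ('a \<Rightarrow>\<^sub>0 rat)" (infixr \<open>*\<^sub>Q\<close> 75) where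
  "c *\<^sub>Q p \<equiv> Poly_Mapping.map ((*) c) p"

abbreviation basis :: "'a \<Rightarrow> ('a \<Rightarrow>\<^sub>0 rat)" where
  "basis k \<equiv> Poly_Mapping.single k 1"

lemma lookup_pscale [simp]: "Poly_Mapping.lookup (c *\<^sub>Q p) k = c * Poly_Mapping.lookup p k"
  by (simp add: Poly_Mapping.map.rep_eq when_def)

text \<open>Makes the type-based theory of subspaces and spans available. Carriers become subspaces
  cut out by a condition on supports; \<open>submodule_free_mod_iff\<close> and
  \<open>lin_span_free_mod\<close> translate from the carrier-based notions.\<close>

interpretation pm: vector_space "(*\<^sub>Q) :: rat \<Rightarrow> ('a \<Rightarrow>\<^sub>0 rat) \<Rightarrow> _"
  by standard (auto intro!: poly_mapping_eqI simp: lookup_add algebra_simps)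

lemma keys_pscale: "Poly_Mapping.keys (c *\<^sub>Q p) \<subseteq> Poly_Mapping.keys p"
  by (auto simp: in_keys_iff)

lemma pscale_mult_left: "(c *\<^sub>Q p) * q = c *\<^sub>Q (p * (q :: 'a::monoid_add \<Rightarrow>\<^sub>0 rat))"
  by (simp add: mult_map_scale_conv_mult mult.assoc)

definition lin :: "('a \<Rightarrow> 'b \<Rightarrow>\<^sub>0 rat) \<Rightarrow> ('a \<Rightarrow>\<^sub>0 rat) \<Rightarrow> 'b \<Rightarrow>\<^sub>0 rat" where
  "lin f p = (\<Sum>k\<in>Poly_Mapping.keys p. Poly_Mapping.lookup p k *\<^sub>Q f k)"

abbreviation linear_pm :: "(('a \<Rightarrow>\<^sub>0 rat) \<Rightarrow> 'b \<Rightarrow>\<^sub>0 rat) \<Rightarrow> bool" where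
  "linear_pm \<equiv> Modules.module_hom (*\<^sub>Q) (*\<^sub>Q)"

lemma linear_pmI:
  assumes "\<And>p q. f (p + q) = f p + f q" "\<And>c p. f (c *\<^sub>Q p) = c *\<^sub>Q f p"
  shows "linear_pm f"
  using assms by unfold_locales (auto simp: pm.scale_right_distrib pm.scale_left_distrib)

lemma linear_pmD:
  assumes "linear_pm f"
  shows "f (p + q) = f p + f q" "f (c *\<^sub>Q p) = c *\<^sub>Q f p" "f (p - q) = f p - f q" "f (- p) = - f p"
    "f 0 = 0" "f (\<Sum>i\<in>I. h i) = (\<Sum>i\<in>I. f (h i))"
  by (fact module_hom.add[OF assms] module_hom.scale[OF assms] module_hom.diff[OF assms]
    module_hom.neg[OF assms] module_hom.zero[OF assms] module_hom.sum[OF assms])+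

lemma lin_superset:
  assumes "finite A" "Poly_Mapping.keys p \<subseteq> A"
  shows "lin f p = (\<Sum>k\<in>A. Poly_Mapping.lookup p k *\<^sub>Q f k)"
  unfolding lin_def by (rule sum.mono_neutral_left) (use assms in \<open>auto simp: in_keys_iff\<close>)

lemma linear_lin: "linear_pm (lin f)"
proof (rule linear_pmI)
  fix p q :: "'a \<Rightarrow>\<^sub>0 rat"
  let ?A = "Poly_Mapping.keys p \<union> Poly_Mapping.keys q"
  have "lin f (p + q) = (\<Sum>k\<in>?A. Poly_Mapping.lookup (p + q) k *\<^sub>Q f k)"
    by (rule lin_superset) (use keys_add[of p q] in auto)
  also have "\<dots> = lin f p + lin f q"
    by (simp add: lin_superset[of ?A] lookup_add pm.scale_left_distrib sum.distrib)
  finally show "lin f (p + q) = lin f p + lin f q" .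
next
  fix c and p :: "'a \<Rightarrow>\<^sub>0 rat"
  have "lin f (c *\<^sub>Q p) = (\<Sum>k\<in>Poly_Mapping.keys p. Poly_Mapping.lookup (c *\<^sub>Q p) k *\<^sub>Q f k)"
    by (rule lin_superset) (use keys_pscale[of c p] in auto)
  also have "\<dots> = c *\<^sub>Q lin f p"
    by (simp add: lin_def pm.scale_sum_right)
  finally show "lin f (c *\<^sub>Q p) = c *\<^sub>Q lin f p" .
qed

lemmas lin_simps = linear_pmD[OF linear_lin]

lemma lin_single [simp]: "lin f (Poly_Mapping.single k c) = c *\<^sub>Q f k"
  by (cases "c = 0") (auto simp: lin_def)

lemma lin_add_fun: "lin (\<lambda>k. f k + g k) p = lin f p + lin g p"
  by (simp add: lin_def pm.scale_right_distrib sum.distrib)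

lemma lin_pscale_fun: "lin (\<lambda>k. c *\<^sub>Q f k) p = c *\<^sub>Q lin f p"
  by (simp add: lin_def pm.scale_sum_right mult.commute del: pm.scale_scale)
     (simp add: mult.commute)

lemma linear_comp: "linear_pm f \<Longrightarrow> linear_pm g \<Longrightarrow> linear_pm (\<lambda>p. f (g p))"
  by (rule linear_pmI) (simp_all add: linear_pmD)

lemma linear_diff: "linear_pm f \<Longrightarrow> linear_pm g \<Longrightarrow> linear_pm (\<lambda>p. f p - g p)"
  by (rule linear_pmI) (simp_all add: linear_pmD pm.scale_right_diff_distrib)

lemma linear_add: "linear_pm f \<Longrightarrow> linear_pm g \<Longrightarrow> linear_pm (\<lambda>p. f p + g p)"
  by (rule linear_pmI) (simp_all add: linear_pmD pm.scale_right_distrib)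

lemma linear_pscale: "linear_pm f \<Longrightarrow> linear_pm (\<lambda>p. c *\<^sub>Q f p)"
  by (rule linear_pmI) (simp_all add: linear_pmD pm.scale_right_distrib pm.scale_left_commute)

lemma linear_id: "linear_pm (\<lambda>p. p)"
  by (rule linear_pmI) auto

lemma linear_lin': "linear_pm f \<Longrightarrow> linear_pm (\<lambda>p. lin h (f p))"
  by (rule linear_comp[OF linear_lin])

lemmas linear_intros = linear_lin linear_lin' linear_diff linear_add linear_pscale linear_id

lemma lin_basis [simp]: "lin basis p = p"
proof (rule poly_mapping_eqI)
  fix k
  have "Poly_Mapping.lookup (lin basis p) k =
     (\<Sum>x\<in>Poly_Mapping.keys p. Poly_Mapping.lookup p x * (1 when x = k))"
    by (simp add: lin_def lookup_sum lookup_single mult_when)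
  also have "\<dots> = Poly_Mapping.lookup p k"
    by (auto simp: when_def if_distrib sum.delta in_keys_iff cong: if_cong)
  finally show "Poly_Mapping.lookup (lin basis p) k = Poly_Mapping.lookup p k" .
qed

lemma lin_subspace:
  assumes "pm.subspace H" "\<And>k. k \<in> Poly_Mapping.keys p \<Longrightarrow> f k \<in> H"
  shows "lin f p \<in> H"
  unfolding lin_def using assms by (intro pm.subspace_sum pm.subspace_scale) auto

lemma linear_basis: "linear_pm f \<Longrightarrow> f p = lin (\<lambda>k. f (basis k)) p"
proof -
  assume f: "linear_pm f"
  have "f p = f (\<Sum>k\<in>Poly_Mapping.keys p. Poly_Mapping.lookup p k *\<^sub>Q basis k)"
    by (metis lin_basis lin_def)
  then show ?thesis
    by (simp only: linear_pmD[OF f] lin_def)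
qed

text \<open>Only basis elements in the support of \<open>p\<close> have to be checked. This is how a
  carrier, being a condition on supports, enters arguments about linear maps that are defined on the
  whole type.\<close>

lemma linear_subspaceI:
  assumes "linear_pm f" "pm.subspace H" "\<And>k. k \<in> Poly_Mapping.keys p \<Longrightarrow> f (basis k) \<in> H"
  shows "f p \<in> H"
  by (subst linear_basis[OF assms(1)]) (intro lin_subspace assms)

lemma subspaceI_keys:
  assumes "pm.subspace H" "\<And>k. k \<in> Poly_Mapping.keys p \<Longrightarrow> basis k \<in> H"
  shows "p \<in> H"
  using linear_subspaceI[OF linear_id assms(1)] assms(2) .

lemma linear_eqI:
  assumes "linear_pm f" "linear_pm g" "\<And>k. k \<in> Poly_Mapping.keys p \<Longrightarrow> f (basis k) = g (basis k)"
  shows "f p = g p"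
  by (subst (1 2) linear_basis) (use assms in \<open>auto simp: lin_def\<close>)

lemma linear_mult_right: "linear_pm f \<Longrightarrow> linear_pm (\<lambda>p. f p * (q :: 'a::monoid_add \<Rightarrow>\<^sub>0 rat))"
  by (rule linear_pmI) (simp_all add: linear_pmD distrib_right pscale_mult_left)

text \<open>Scaling is left multiplication by \<open>Poly_Mapping.single 0 c\<close>. The monoid of
  exponents need not be commutative, so that this constant is central is checked on basis
  elements.\<close>

lemma pscale_mult_right: "p * (c *\<^sub>Q q) = c *\<^sub>Q (p * (q :: 'a::monoid_add \<Rightarrow>\<^sub>0 rat))"
proof -
  have "p * Poly_Mapping.single 0 c = c *\<^sub>Q p"
    by (rule linear_eqI[of "\<lambda>p. p * Poly_Mapping.single 0 c"])
       (auto intro!: linear_mult_right linear_pscale linear_id simp: mult_single)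
  then show ?thesis
    by (metis mult.assoc mult_map_scale_conv_mult)
qed

lemma linear_mult_left: "linear_pm f \<Longrightarrow> linear_pm (\<lambda>p. (q :: 'a::monoid_add \<Rightarrow>\<^sub>0 rat) * f p)"
  by (rule linear_pmI) (simp_all add: linear_pmD distrib_left pscale_mult_right)

lemmas linear_mult_intros = linear_mult_left linear_mult_right

lemma subspace_vimage:
  assumes "linear_pm f" "pm.subspace H"
  shows "pm.subspace {p. f p \<in> H}"
  using assms by (auto simp: pm.subspace_def linear_pmD)

lemma subspace_keys: "pm.subspace {p. Poly_Mapping.keys p \<subseteq> S}"
proof (rule pm.subspaceI)
  fix p q :: "'a \<Rightarrow>\<^sub>0 rat" assume "p \<in> {p. Poly_Mapping.keys p \<subseteq> S}" "q \<in> {p. Poly_Mapping.keys p \<subseteq> S}"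
  then show "p + q \<in> {p. Poly_Mapping.keys p \<subseteq> S}"
    using keys_add[of p q] by auto
next
  fix c and p :: "'a \<Rightarrow>\<^sub>0 rat" assume "p \<in> {p. Poly_Mapping.keys p \<subseteq> S}"
  then show "c *\<^sub>Q p \<in> {p. Poly_Mapping.keys p \<subseteq> S}"
    using keys_pscale[of c p] by auto
qed simp

lemma lin_lin: "lin f (lin g p) = lin (\<lambda>k. lin f (g k)) p"
  by (rule linear_eqI[of "\<lambda>p. lin f (lin g p)"]) (intro linear_intros | simp)+

lemma keys_lin: "Poly_Mapping.keys (lin f p) \<subseteq> (\<Union>k\<in>Poly_Mapping.keys p. Poly_Mapping.keys (f k))"
proof -
  have "lin f p \<in> {q. Poly_Mapping.keys q \<subseteq> (\<Union>k\<in>Poly_Mapping.keys p. Poly_Mapping.keys (f k))}"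
    by (rule lin_subspace[OF subspace_keys]) auto
  then show ?thesis by simp
qed

section \<open>Bilinear extension and the convolution product\<close>

lemma bilin_ext_lin: "bilin_ext f p q = lin (\<lambda>a. lin (\<lambda>b. basis (f a b)) q) p"
  by (simp add: bilin_ext_def lin_def pm.scale_sum_right)

lemma linear_bilin_left: "linear_pm f \<Longrightarrow> linear_pm (\<lambda>p. bilin_ext h (f p) q)"
  unfolding bilin_ext_lin by (intro linear_intros)

lemma linear_bilin_right:
  assumes "linear_pm f" shows "linear_pm (\<lambda>p. bilin_ext h q (f p))"
proof -
  have "linear_pm (\<lambda>p. bilin_ext h q p)"
    unfolding bilin_ext_lin
    by (rule linear_pmI) (simp_all add: lin_simps lin_add_fun lin_pscale_fun)
  then show ?thesis using assms by (rule linear_comp)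
qed

lemma bilin_ext_single [simp]:
  "bilin_ext h (Poly_Mapping.single a c) (Poly_Mapping.single b d) = Poly_Mapping.single (h a b) (c * d)"
  by (simp add: bilin_ext_lin)

lemmas bilin_ext_simps =
  linear_pmD[OF linear_bilin_left[OF linear_id]] linear_pmD[OF linear_bilin_right[OF linear_id]]

lemma bilin_ext_eqI:
  assumes "\<And>q. linear_pm (\<lambda>p. B p q)" "\<And>p. linear_pm (\<lambda>q. B p q)"
    and "\<And>a b. B (basis a) (basis b) = basis (h a b)"
  shows "B p q = bilin_ext h p q"
proof (rule linear_eqI[of "\<lambda>p. B p q"])
  fix a
  show "B (basis a) q = bilin_ext h (basis a) q"
    by (rule linear_eqI[of "B (basis a)"]) (auto intro: assms linear_bilin_right[OF linear_id])
qed (auto intro: assms linear_bilin_left[OF linear_id])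

text \<open>Identifies the product inside \<open>tensor_mult\<close> with convolution, whose ring
  laws are already available.\<close>

lemma bilin_ext_append: "bilin_ext (@) p q = p * q"
  by (rule bilin_ext_eqI[symmetric]) (auto intro: linear_mult_intros linear_id simp: mult_single plus_list_def)

lemma keys_bilin_ext:
  "Poly_Mapping.keys (bilin_ext h p q) \<subseteq> {h a b | a b. a \<in> Poly_Mapping.keys p \<and> b \<in> Poly_Mapping.keys q}"
  unfolding bilin_ext_lin
  by (rule order_trans[OF keys_lin UN_least], rule order_trans[OF keys_lin UN_least]) auto

section \<open>Modules over the rationals and their quotients\<close>

abbreviation rat_module :: "(rat, 'a, 'm) module_scheme \<Rightarrow> bool" where
  "rat_module \<equiv> Module.module rat_ring"

lemma rat_ring_simps [simp]:
  "carrier rat_ring = UNIV" "x \<otimes>\<^bsub>rat_ring\<^esub> y = x * y" "\<one>\<^bsub>rat_ring\<^esub> = 1" "\<zero>\<^bsub>rat_ring\<^esub> = 0"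
  "x \<oplus>\<^bsub>rat_ring\<^esub> y = x + y"
  by (simp_all add: rat_ring_def)

lemma cring_rat_ring: "cring rat_ring"
proof (rule cringI)
  show "abelian_group rat_ring"
    by (rule abelian_groupI) (auto intro: exI[of _ "- x" for x] simp: add.assoc)
  show "Group.comm_monoid rat_ring"
    by (rule comm_monoidI) auto
qed (simp add: algebra_simps)

text \<open>Additive inverses are obtained by scaling with \<open>- 1\<close>. This is why
  \<open>smult_zero\<close> is a premise: without inverses it cannot be derived from
  distributivity.\<close>

lemma rat_moduleI:
  assumes add_closed: "\<And>x y. x \<in> carrier M \<Longrightarrow> y \<in> carrier M \<Longrightarrow> x \<oplus>\<^bsub>M\<^esub> y \<in> carrier M"
    and zero_closed: "\<zero>\<^bsub>M\<^esub> \<in> carrier M"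
    and assoc: "\<And>x y z. x \<in> carrier M \<Longrightarrow> y \<in> carrier M \<Longrightarrow> z \<in> carrier M \<Longrightarrow>
      (x \<oplus>\<^bsub>M\<^esub> y) \<oplus>\<^bsub>M\<^esub> z = x \<oplus>\<^bsub>M\<^esub> (y \<oplus>\<^bsub>M\<^esub> z)"
    and comm: "\<And>x y. x \<in> carrier M \<Longrightarrow> y \<in> carrier M \<Longrightarrow> x \<oplus>\<^bsub>M\<^esub> y = y \<oplus>\<^bsub>M\<^esub> x"
    and l_zero: "\<And>x. x \<in> carrier M \<Longrightarrow> \<zero>\<^bsub>M\<^esub> \<oplus>\<^bsub>M\<^esub> x = x"
    and smult_closed: "\<And>c x. x \<in> carrier M \<Longrightarrow> c \<odot>\<^bsub>M\<^esub> x \<in> carrier M"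
    and smult_l_distr: "\<And>c d x. x \<in> carrier M \<Longrightarrow> (c + d) \<odot>\<^bsub>M\<^esub> x = c \<odot>\<^bsub>M\<^esub> x \<oplus>\<^bsub>M\<^esub> d \<odot>\<^bsub>M\<^esub> x"
    and smult_r_distr: "\<And>c x y. x \<in> carrier M \<Longrightarrow> y \<in> carrier M \<Longrightarrow>
      c \<odot>\<^bsub>M\<^esub> (x \<oplus>\<^bsub>M\<^esub> y) = c \<odot>\<^bsub>M\<^esub> x \<oplus>\<^bsub>M\<^esub> c \<odot>\<^bsub>M\<^esub> y"
    and smult_assoc: "\<And>c d x. x \<in> carrier M \<Longrightarrow> (c * d) \<odot>\<^bsub>M\<^esub> x = c \<odot>\<^bsub>M\<^esub> (d \<odot>\<^bsub>M\<^esub> x)"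
    and smult_one: "\<And>x. x \<in> carrier M \<Longrightarrow> 1 \<odot>\<^bsub>M\<^esub> x = x"
    and smult_zero: "\<And>x. x \<in> carrier M \<Longrightarrow> 0 \<odot>\<^bsub>M\<^esub> x = \<zero>\<^bsub>M\<^esub>"
  shows "rat_module M"
proof (rule moduleI)
  show "abelian_group M"
  proof (rule abelian_groupI)
    fix x assume x: "x \<in> carrier M"
    have "(- 1) \<odot>\<^bsub>M\<^esub> x \<oplus>\<^bsub>M\<^esub> x = \<zero>\<^bsub>M\<^esub>"
      using smult_l_distr[OF x, of "- 1" 1] by (simp add: smult_zero smult_one x)
    then show "\<exists>y\<in>carrier M. y \<oplus>\<^bsub>M\<^esub> x = \<zero>\<^bsub>M\<^esub>"
      using smult_closed[OF x] by blast
  qed (use assms in auto)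
qed (use assms cring_rat_ring in auto)

lemma rat_module_smult_minus:
  assumes "rat_module M" "x \<in> carrier M" "y \<in> carrier M"
  shows "x \<ominus>\<^bsub>M\<^esub> y = x \<oplus>\<^bsub>M\<^esub> (- 1) \<odot>\<^bsub>M\<^esub> y"
proof -
  interpret Module.module rat_ring M by fact
  have "y \<oplus>\<^bsub>M\<^esub> (- 1) \<odot>\<^bsub>M\<^esub> y = \<zero>\<^bsub>M\<^esub>"
    using smult_l_distr[of 1 "- 1" y] smult_one[of y] smult_l_null[of y] assms by simp
  then have "(- 1) \<odot>\<^bsub>M\<^esub> y = \<ominus>\<^bsub>M\<^esub> y"
    using assms M.minus_equality[of "(- 1) \<odot>\<^bsub>M\<^esub> y" y] by (simp add: M.a_comm)
  then show ?thesis by (simp add: a_minus_def)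
qed

lemma submodule_rat_iff:
  assumes "rat_module M"
  shows "submodule H rat_ring M \<longleftrightarrow> H \<subseteq> carrier M \<and> \<zero>\<^bsub>M\<^esub> \<in> H \<and>
    (\<forall>x\<in>H. \<forall>y\<in>H. x \<oplus>\<^bsub>M\<^esub> y \<in> H) \<and> (\<forall>c. \<forall>x\<in>H. c \<odot>\<^bsub>M\<^esub> x \<in> H)" (is "_ \<longleftrightarrow> ?R")
proof -
  interpret Module.module rat_ring M by fact
  show ?thesis
  proof
    assume H: "submodule H rat_ring M"
    have "\<zero>\<^bsub>M\<^esub> \<in> H"
      using subgroup.one_closed[OF submodule.axioms(1)[OF H]] by simp
    then show ?R using submoduleE[OF H] by auto
  next
    assume R: ?R
    show "submodule H rat_ring M"
    proof (rule submoduleI)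
      fix x assume x: "x \<in> H"
      then have "\<ominus>\<^bsub>M\<^esub> x = (- 1) \<odot>\<^bsub>M\<^esub> x"
        using R rat_module_smult_minus[OF assms, of "\<zero>\<^bsub>M\<^esub>" x] by (auto simp: a_minus_def subset_iff)
      then show "\<ominus>\<^bsub>M\<^esub> x \<in> H" using R x by auto
    qed (use R in auto)
  qed
qed

lemma lin_span_submodule:
  assumes "rat_module M" "S \<subseteq> carrier M"
  shows "submodule (lin_span M S) rat_ring M"
  using Module.module.carrier_is_submodule[OF assms(1)] assms(2)
  unfolding lin_span_def submodule_rat_iff[OF assms(1)] by blast

lemma lin_span_superset: "S \<subseteq> lin_span M S"
  by (auto simp: lin_span_def)

lemma lin_span_minimal: "submodule H rat_ring M \<Longrightarrow> S \<subseteq> H \<Longrightarrow> lin_span M S \<subseteq> H"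
  by (auto simp: lin_span_def)

section \<open>Free modules and their spans\<close>

lemma free_mod_simps [simp]:
  "carrier (free_mod S) = {p. Poly_Mapping.keys p \<subseteq> S}" "\<zero>\<^bsub>free_mod S\<^esub> = 0"
  "p \<oplus>\<^bsub>free_mod S\<^esub> q = p + q" "c \<odot>\<^bsub>free_mod S\<^esub> p = c *\<^sub>Q p"
  by (simp_all add: free_mod_def)

lemma rat_module_free_mod: "rat_module (free_mod S)"
  using subspace_keys[of S]
  by (intro rat_moduleI) (auto simp: pm.subspace_def add_ac pm.scale_left_distrib pm.scale_right_distrib)

lemma submodule_free_mod_iff:
  "submodule H rat_ring (free_mod S) \<longleftrightarrow> pm.subspace H \<and> (\<forall>p\<in>H. Poly_Mapping.keys p \<subseteq> S)"
  unfolding submodule_rat_iff[OF rat_module_free_mod] pm.subspace_def by auto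

lemma lin_span_free_mod:
  assumes "G \<subseteq> carrier (free_mod S)"
  shows "lin_span (free_mod S) G = pm.span G"
proof
  have "pm.span G \<subseteq> {p. Poly_Mapping.keys p \<subseteq> S}"
    using assms by (intro pm.span_minimal subspace_keys) auto
  then have "submodule (pm.span G) rat_ring (free_mod S)"
    unfolding submodule_free_mod_iff by auto
  then show "lin_span (free_mod S) G \<subseteq> pm.span G"
    by (rule lin_span_minimal) (rule pm.span_superset)
  show "pm.span G \<subseteq> lin_span (free_mod S) G"
    using lin_span_submodule[OF rat_module_free_mod assms] lin_span_superset[of G "free_mod S"]
    by (intro pm.span_minimal) (auto simp: submodule_free_mod_iff)
qed

text \<open>One theory for the five quotients that occur: tensor powers, the enveloping algebra, its
  graded pieces, symmetric powers and the free Lie algebra. Only the linear structure is treated;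
  products of cosets are computed separately for each algebra.\<close>

locale rat_submodule = Module.module rat_ring M for M :: "(rat, 'a, 'm) module_scheme" (structure) +
  fixes H :: "'a set"
  assumes submod: "submodule H rat_ring M"
begin

lemma abelian_subgroup_H: "abelian_subgroup H M"
  by (intro abelian_subgroupI3 additive_subgroupI submodule.axioms(1)[OF submod]) unfold_locales

sublocale H: abelian_subgroup H M by (rule abelian_subgroup_H)

lemma smult_H: "x \<in> H \<Longrightarrow> c \<odot> x \<in> H"
  using submodule.smult_closed[OF submod] by simp

lemma coset_eq_iff:
  assumes "x \<in> carrier M" "y \<in> carrier M"
  shows "H +> x = H +> y \<longleftrightarrow> x \<ominus> y \<in> H"
proof -
  have "H +> x = H +> y \<longleftrightarrow> x \<in> H +> y"
    using assms H.a_repr_independence' H.a_repr_independenceD by metis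
  then show ?thesis
    using H.a_rcos_module[of y x] assms by (simp add: a_minus_def)
qed

lemma coset_eq_self_iff: "x \<in> carrier M \<Longrightarrow> H +> x = H \<longleftrightarrow> x \<in> H"
  using H.a_rcos_self H.a_rcos_const by metis

lemma mem_coset_iff:
  assumes "y \<in> carrier M"
  shows "x \<in> H +> y \<longleftrightarrow> x \<in> carrier M \<and> H +> x = H +> y"
  using assms H.a_elemrcos_carrier H.a_repr_independence' H.a_repr_independenceD by metis

lemma quot_simps:
  "carrier (quot_mod M H) = (\<lambda>x. H +> x) ` carrier M"
  "\<zero>\<^bsub>quot_mod M H\<^esub> = H"
  by (auto simp: quot_mod_def FactRing_simps)

lemma quot_add:
  "x \<in> carrier M \<Longrightarrow> y \<in> carrier M \<Longrightarrow> (H +> x) \<oplus>\<^bsub>quot_mod M H\<^esub> (H +> y) = H +> (x \<oplus> y)"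
  by (simp add: quot_mod_def FactRing_simps H.a_rcos_sum)

lemma quot_smult:
  assumes x: "x \<in> carrier M"
  shows "c \<odot>\<^bsub>quot_mod M H\<^esub> (H +> x) = H +> (c \<odot> x)"
proof -
  have "H <+>\<^bsub>M\<^esub> (\<lambda>x. c \<odot> x) ` (H +> x) = H +> (c \<odot> x)"
  proof (intro equalityI subsetI)
    fix z assume "z \<in> H <+>\<^bsub>M\<^esub> (\<lambda>x. c \<odot> x) ` (H +> x)"
    then obtain h h' where h: "h \<in> H" "h' \<in> H" "z = h \<oplus> c \<odot> (h' \<oplus> x)"
      by (auto simp: set_add_def' a_r_coset_def')
    then have "z = (h \<oplus> c \<odot> h') \<oplus> c \<odot> x"
      using x by (simp add: smult_r_distr a_assoc)
    moreover have "h \<oplus> c \<odot> h' \<in> H" using h smult_H by simp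
    ultimately show "z \<in> H +> (c \<odot> x)" by (auto simp: a_r_coset_def')
  next
    fix z assume "z \<in> H +> (c \<odot> x)"
    moreover have "x \<in> H +> x" using x by (rule H.a_rcos_self)
    ultimately show "z \<in> H <+>\<^bsub>M\<^esub> (\<lambda>x. c \<odot> x) ` (H +> x)"
      by (auto simp: set_add_def' a_r_coset_def'[of M H "c \<odot> x"])
  qed
  then show ?thesis by (simp add: quot_mod_def)
qed

lemma coset_carrier: "x \<in> carrier M \<Longrightarrow> H +> x \<in> carrier (quot_mod M H)"
  by (auto simp: quot_simps)

lemma quot_zero_eq: "\<zero>\<^bsub>quot_mod M H\<^esub> = H +> \<zero>"
  by (simp add: quot_simps H.a_rcos_const)

lemma rat_module_quot: "rat_module (quot_mod M H)"
  by (rule rat_moduleI)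
    (auto simp: quot_simps(1) quot_zero_eq quot_add quot_smult M.a_ac
      smult_l_distr[simplified] smult_r_distr[simplified] smult_assoc1[simplified]
      smult_one[simplified] smult_l_null[simplified])

lemma quot_minus:
  assumes "x \<in> carrier M" "y \<in> carrier M"
  shows "(H +> x) \<ominus>\<^bsub>quot_mod M H\<^esub> (H +> y) = H +> (x \<ominus> y)"
  using assms rat_module_smult_minus[OF rat_module_quot coset_carrier coset_carrier, of x y]
    rat_module_smult_minus[OF module_axioms, of x y]
  by (simp add: quot_add quot_smult smult_closed[simplified])

lemma quot_finsum:
  assumes "finite I" "\<And>i. i \<in> I \<Longrightarrow> f i \<in> carrier M"
  shows "(\<Oplus>\<^bsub>quot_mod M H\<^esub>i\<in>I. H +> f i) = H +> (\<Oplus>i\<in>I. f i)"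
proof -
  interpret Q: Module.module rat_ring "quot_mod M H" by (rule rat_module_quot)
  show ?thesis using assms
  proof (induction I rule: finite_induct)
    case empty
    show ?case by (simp add: quot_zero_eq)
  next
    case (insert i I)
    then have "(\<Oplus>\<^bsub>quot_mod M H\<^esub>i\<in>insert i I. H +> f i) = (H +> f i) \<oplus>\<^bsub>quot_mod M H\<^esub> (\<Oplus>\<^bsub>quot_mod M H\<^esub>i\<in>I. H +> f i)"
      by (intro Q.M.finsum_insert) (auto intro: coset_carrier)
    also have "\<dots> = (H +> f i) \<oplus>\<^bsub>quot_mod M H\<^esub> (H +> (\<Oplus>i\<in>I. f i))"
      using insert by simp
    also have "\<dots> = H +> (f i \<oplus> (\<Oplus>i\<in>I. f i))"
      using insert by (intro quot_add finsum_closed) auto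
    also have "\<dots> = H +> (\<Oplus>i\<in>insert i I. f i)"
      using insert by (subst finsum_insert) auto
    finally show ?case .
  qed
qed

end

lemma finsum_free_mod:
  assumes "finite I" "\<And>i. i \<in> I \<Longrightarrow> Poly_Mapping.keys (f i) \<subseteq> S"
  shows "(\<Oplus>\<^bsub>free_mod S\<^esub>i\<in>I. f i) = (\<Sum>i\<in>I. f i)"
proof -
  interpret Module.module rat_ring "free_mod S" by (rule rat_module_free_mod)
  show ?thesis using assms by (induction I rule: finite_induct) (auto simp: Pi_def)
qed

lemma free_mod_minus:
  "Poly_Mapping.keys p \<subseteq> S \<Longrightarrow> Poly_Mapping.keys q \<subseteq> S \<Longrightarrow> p \<ominus>\<^bsub>free_mod S\<^esub> q = p - q"
  by (simp add: rat_module_smult_minus[OF rat_module_free_mod])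

text \<open>The induced map is written in the shape of \<^const>\<open>pbw_map\<close>.\<close>
lemma (in rat_submodule) induced_lin_iso:
  assumes N: "rat_module N"
    and closed: "\<And>x. x \<in> carrier M \<Longrightarrow> f x \<in> carrier N"
    and add: "\<And>x y. x \<in> carrier M \<Longrightarrow> y \<in> carrier M \<Longrightarrow> f (x \<oplus> y) = f x \<oplus>\<^bsub>N\<^esub> f y"
    and smult: "\<And>c x. x \<in> carrier M \<Longrightarrow> f (c \<odot> x) = c \<odot>\<^bsub>N\<^esub> f x"
    and surj: "\<And>y. y \<in> carrier N \<Longrightarrow> \<exists>x\<in>carrier M. f x = y"
    and kernel: "\<And>x. x \<in> carrier M \<Longrightarrow> f x = \<zero>\<^bsub>N\<^esub> \<longleftrightarrow> x \<in> H"
  shows "(\<lambda>S. the_elem (f ` S)) \<in> lin_iso (quot_mod M H) N"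
proof -
  interpret N: Module.module rat_ring N by fact
  \<comment> \<open>Read from right to left this is well-definedness of the induced map, from left
    to right its injectivity.\<close>
  have f_eq: "f x = f y \<longleftrightarrow> H +> x = H +> y" if "x \<in> carrier M" "y \<in> carrier M" for x y
  proof -
    have "f x = f y \<longleftrightarrow> f x \<ominus>\<^bsub>N\<^esub> f y = \<zero>\<^bsub>N\<^esub>"
      using that closed N.M.minus_equality[of "f x" "\<ominus>\<^bsub>N\<^esub> f y"]
      by (auto simp: a_minus_def N.M.r_neg)
    also have "f x \<ominus>\<^bsub>N\<^esub> f y = f (x \<ominus> y)"
      using that closed
      by (simp add: rat_module_smult_minus[OF N] rat_module_smult_minus[OF module_axioms] add smult)
    finally show ?thesis using that by (simp add: kernel coset_eq_iff)
  qed
  have val: "the_elem (f ` (H +> x)) = f x" if x: "x \<in> carrier M" for x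
  proof -
    have "f ` (H +> x) = {f x}"
      using x f_eq H.a_rcos_self by (auto simp: mem_coset_iff)
    then show ?thesis by simp
  qed
  have "bij_betw (\<lambda>S. the_elem (f ` S)) (carrier (quot_mod M H)) (carrier N)"
  proof (rule bij_betwI')
    fix S T assume "S \<in> carrier (quot_mod M H)" "T \<in> carrier (quot_mod M H)"
    then show "the_elem (f ` S) = the_elem (f ` T) \<longleftrightarrow> S = T"
      by (auto simp: quot_simps val f_eq)
  next
    fix S assume "S \<in> carrier (quot_mod M H)"
    then show "the_elem (f ` S) \<in> carrier N" by (auto simp: quot_simps val closed)
  next
    fix y assume "y \<in> carrier N"
    then obtain x where "x \<in> carrier M" "f x = y" using surj by blast
    then show "\<exists>S\<in>carrier (quot_mod M H). y = the_elem (f ` S)"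
      by (intro bexI[of _ "H +> x"]) (auto simp: val coset_carrier)
  qed
  then show ?thesis
    by (auto simp: lin_iso_def quot_simps(1) quot_add quot_smult val add smult)
qed

section \<open>The tensor algebra as a quotient of the algebra of words\<close>

definition hcomp :: "nat \<Rightarrow> ('a list \<Rightarrow>\<^sub>0 rat) \<Rightarrow> 'a list \<Rightarrow>\<^sub>0 rat" where
  "hcomp n = lin (\<lambda>w. if length w = n then basis w else 0)"

lemma linear_hcomp: "linear_pm (hcomp n)"
  unfolding hcomp_def by (rule linear_lin)

lemmas hcomp_simps = linear_pmD[OF linear_hcomp]

lemma hcomp_single: "hcomp n (Poly_Mapping.single w c) = (if length w = n then Poly_Mapping.single w c else 0)"
  by (simp add: hcomp_def)

lemma keys_hcomp: "Poly_Mapping.keys (hcomp n p) \<subseteq> {w \<in> Poly_Mapping.keys p. length w = n}"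
proof -
  have "Poly_Mapping.keys (hcomp n p) \<subseteq>
      (\<Union>w\<in>Poly_Mapping.keys p. Poly_Mapping.keys (if length w = n then basis w else 0))"
    unfolding hcomp_def by (rule keys_lin)
  then show ?thesis by (auto split: if_splits)
qed

lemma hcomp_homogeneous:
  assumes "\<And>w. w \<in> Poly_Mapping.keys p \<Longrightarrow> length w = m"
  shows "hcomp n p = (if n = m then p else 0)"
proof -
  have "hcomp n p = (if n = m then 1 else 0) *\<^sub>Q p"
  proof (rule linear_eqI[of "hcomp n" "\<lambda>p. (if n = m then 1 else 0) *\<^sub>Q p"])
    fix w assume "w \<in> Poly_Mapping.keys p"
    then show "hcomp n (basis w) = (if n = m then 1 else 0) *\<^sub>Q basis w"
      using assms[of w] by (simp add: hcomp_single)
  qed (intro linear_hcomp linear_pscale linear_id)+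
  then show ?thesis by simp
qed

lemma sum_hcomp: "(\<Sum>n\<in>length ` Poly_Mapping.keys p. hcomp n p) = p"
proof -
  have "lin (\<lambda>w. \<Sum>n\<in>length ` Poly_Mapping.keys p. if length w = n then basis w else 0) p = lin basis p"
    unfolding lin_def by (rule sum.cong) (auto simp: sum.delta)
  moreover have "lin (\<lambda>w. \<Sum>n\<in>N. if length w = n then basis w else 0) p = (\<Sum>n\<in>N. hcomp n p)" if "finite N" for N
    using that
  proof (induction N rule: finite_induct)
    case empty
    show ?case by (simp add: lin_def)
  next
    case (insert x F)
    then show ?case by (simp only: sum.insert[OF insert(1,2)] lin_add_fun hcomp_def)
  qed
  ultimately show ?thesis by simp
qed

text \<open>The Cauchy product, in the shape of the multiplication of \<open>tensor_algebra\<close>,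
  so that \<open>cls_mult\<close> can be proved degree by degree.\<close>

lemma hcomp_mult: "hcomp n (p * q) = (\<Sum>i\<in>{..n}. hcomp i p * hcomp (n - i) q)"
proof -
  have lin_sum: "linear_pm (\<lambda>p. \<Sum>i\<in>I. f i p)" if "\<And>i. linear_pm (f i)" for f :: "nat \<Rightarrow> _" and I
    by (rule linear_pmI) (simp_all add: linear_pmD[OF that] sum.distrib pm.scale_sum_right)
  show ?thesis
  proof (rule linear_eqI[of "\<lambda>p. hcomp n (p * q)"])
    show "linear_pm (\<lambda>p. hcomp n (p * q))"
      by (intro linear_comp[OF linear_hcomp] linear_mult_intros linear_id)
    show "linear_pm (\<lambda>p. \<Sum>i\<in>{..n}. hcomp i p * hcomp (n - i) q)"
      by (intro lin_sum linear_mult_right linear_hcomp)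
    fix u
    show "hcomp n (basis u * q) = (\<Sum>i\<in>{..n}. hcomp i (basis u) * hcomp (n - i) q)"
    proof (rule linear_eqI[of "\<lambda>q. hcomp n (basis u * q)"])
      show "linear_pm (\<lambda>q. hcomp n (basis u * q))"
        by (intro linear_comp[OF linear_hcomp] linear_mult_intros linear_id)
      show "linear_pm (\<lambda>q. \<Sum>i\<in>{..n}. hcomp i (basis u) * hcomp (n - i) q)"
        by (intro lin_sum linear_mult_left linear_hcomp)
      fix v
      have "(\<Sum>i\<in>{..n}. hcomp i (basis u) * hcomp (n - i) (basis v)) =
          (\<Sum>i\<in>{..n}. if length u = i then basis u * hcomp (n - i) (basis v) else 0)"
        by (intro sum.cong) (auto simp: hcomp_single)
      also have "\<dots> = (if length u \<le> n then basis u * hcomp (n - length u) (basis v) else 0)"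
        by (auto simp: sum.delta')
      also have "\<dots> = hcomp n (basis u * basis v)"
        by (auto simp: hcomp_single mult_single plus_list_def)
      finally show "hcomp n (basis u * basis v) = (\<Sum>i\<in>{..n}. hcomp i (basis u) * hcomp (n - i) (basis v))" ..
    qed
  qed
qed

section \<open>Tensors represented by formal combinations of words\<close>

locale rat_mod = Module.module rat_ring g for g :: "(rat, 'a, 'm) module_scheme" (structure)
begin

definition Wn :: "nat \<Rightarrow> ('a list \<Rightarrow>\<^sub>0 rat) set" where
  "Wn n = {p. Poly_Mapping.keys p \<subseteq> words g n}"

definition W :: "('a list \<Rightarrow>\<^sub>0 rat) set" where
  "W = {p. Poly_Mapping.keys p \<subseteq> lists (carrier g)}"

abbreviation T where "T \<equiv> tensor_algebra g"

text \<open>The tensor represented by \<open>p\<close>, as the family of classes of its homogeneous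
  components. On \<open>W\<close> this is a surjective algebra homomorphism onto \<open>T\<close>,
  with kernel given by \<open>cls_eq_iff\<close>; the module and ring laws of \<open>T\<close> are
  inherited from the convolution algebra along it.\<close>

definition cls :: "('a list \<Rightarrow>\<^sub>0 rat) \<Rightarrow> nat \<Rightarrow> ('a list \<Rightarrow>\<^sub>0 rat) set" where
  "cls p = (\<lambda>n. multilin_rel g n +>\<^bsub>free_mod (words g n)\<^esub> hcomp n p)"

definition multilin_gens :: "nat \<Rightarrow> ('a list \<Rightarrow>\<^sub>0 rat) set" where
  "multilin_gens n =
     {basis (us @ (x \<oplus> y) # vs) - basis (us @ x # vs) - basis (us @ y # vs) | us x y vs.
         us @ x # vs \<in> words g n \<and> us @ y # vs \<in> words g n} \<union>
      {basis (us @ (c \<odot> x) # vs) - Poly_Mapping.single (us @ x # vs) c | us c x vs.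
         us @ x # vs \<in> words g n}"

lemma mem_W: "p \<in> W \<longleftrightarrow> Poly_Mapping.keys p \<subseteq> lists (carrier g)"
  by (simp add: W_def)

lemma mem_Wn: "p \<in> Wn n \<longleftrightarrow> Poly_Mapping.keys p \<subseteq> words g n"
  by (simp add: Wn_def)

lemma words_lists: "w \<in> words g n \<longleftrightarrow> w \<in> lists (carrier g) \<and> length w = n"
  by (auto simp: words_def)

lemma Wn_subset: "p \<in> Wn n \<Longrightarrow> p \<in> W"
  by (auto simp: words_def mem_W mem_Wn)

lemma hcomp_W: "p \<in> W \<Longrightarrow> hcomp n p \<in> Wn n"
  using keys_hcomp[of n p] by (auto simp: words_def mem_W mem_Wn)

lemma hcomp_Wn: "p \<in> Wn n \<Longrightarrow> hcomp m p = (if m = n then p else 0)"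
  by (rule hcomp_homogeneous) (auto simp: words_def mem_Wn)

lemma W_mult: "p \<in> W \<Longrightarrow> q \<in> W \<Longrightarrow> p * q \<in> W"
  using keys_mult[of p q] by (force simp: plus_list_def mem_W)

lemma Wn_mult: "p \<in> Wn i \<Longrightarrow> q \<in> Wn j \<Longrightarrow> p * q \<in> Wn (i + j)"
  using keys_mult[of p q] by (force simp: plus_list_def words_def mem_Wn)

lemma subspace_W: "pm.subspace W"
  unfolding W_def by (rule subspace_keys)

lemma subspace_Wn: "pm.subspace (Wn n)"
  unfolding Wn_def by (rule subspace_keys)

lemmas W_closed = W_mult pm.subspace_add[OF subspace_W] pm.subspace_diff[OF subspace_W]
  pm.subspace_scale[OF subspace_W] pm.subspace_0[OF subspace_W] pm.subspace_sum[OF subspace_W]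

lemma one_W: "1 \<in> W"
  by (simp add: zero_list_def mem_W)

lemma multilin_gens_Wn: "multilin_gens n \<subseteq> Wn n"
proof -
  have "basis (us @ (x \<oplus> y) # vs) - basis (us @ x # vs) - basis (us @ y # vs) \<in> Wn n"
    if "us @ x # vs \<in> words g n" "us @ y # vs \<in> words g n" for us vs x y
    using that by (intro pm.subspace_diff subspace_Wn) (auto simp: words_def mem_Wn)
  moreover have "basis (us @ (c \<odot> x) # vs) - Poly_Mapping.single (us @ x # vs) c \<in> Wn n"
    if "us @ x # vs \<in> words g n" for us vs x c
    using that by (intro pm.subspace_diff subspace_Wn) (auto simp: words_def mem_Wn smult_closed[simplified])
  ultimately show ?thesis unfolding multilin_gens_def by blast
qed

lemma multilin_rel_span: "multilin_rel g n = pm.span (multilin_gens n)"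
  unfolding multilin_rel_def multilin_gens_def[symmetric]
  using multilin_gens_Wn by (intro lin_span_free_mod) (simp add: Wn_def)

lemma multilin_rel_Wn: "multilin_rel g n \<subseteq> Wn n"
  unfolding multilin_rel_span by (intro pm.span_minimal multilin_gens_Wn subspace_Wn)

lemma subspace_multilin_rel: "pm.subspace (multilin_rel g n)"
  unfolding multilin_rel_span by (rule pm.subspace_span)

sublocale tp: rat_submodule "free_mod (words g n)" "multilin_rel g n" for n
  by (intro rat_submodule.intro rat_submodule_axioms.intro rat_module_free_mod)
    (use multilin_rel_Wn subspace_multilin_rel in \<open>auto simp: submodule_free_mod_iff Wn_def\<close>)

abbreviation tcoset :: "nat \<Rightarrow> ('a list \<Rightarrow>\<^sub>0 rat) \<Rightarrow> ('a list \<Rightarrow>\<^sub>0 rat) set" where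
  "tcoset n p \<equiv> multilin_rel g n +>\<^bsub>free_mod (words g n)\<^esub> p"

lemma tcoset_eq_iff: "p \<in> Wn n \<Longrightarrow> q \<in> Wn n \<Longrightarrow> tcoset n p = tcoset n q \<longleftrightarrow> p - q \<in> multilin_rel g n"
  using tp.coset_eq_iff[of p n q] by (simp add: free_mod_minus mem_Wn)

text \<open>The word is absorbed into the prefix \<open>us\<close> of a generator, so generators go
  to generators. Multiplication from the right lengthens the suffix \<open>vs\<close> in the same
  way.\<close>

lemma multilin_rel_mult_basis_left:
  assumes "p \<in> multilin_rel g n" "w \<in> words g m"
  shows "basis w * p \<in> multilin_rel g (m + n)"
proof -
  have "pm.span (multilin_gens n) \<subseteq> {p. basis w * p \<in> multilin_rel g (m + n)}"
  proof (rule pm.span_minimal)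
    show "pm.subspace {p. basis w * p \<in> multilin_rel g (m + n)}"
      by (intro subspace_vimage[OF linear_mult_left[OF linear_id] subspace_multilin_rel])
    show "multilin_gens n \<subseteq> {p. basis w * p \<in> multilin_rel g (m + n)}"
    proof
      fix p assume "p \<in> multilin_gens n"
      then consider us x y vs where "p = basis (us @ (x \<oplus> y) # vs) - basis (us @ x # vs) - basis (us @ y # vs)"
           "us @ x # vs \<in> words g n" "us @ y # vs \<in> words g n"
        | us x c vs where "p = basis (us @ (c \<odot> x) # vs) - Poly_Mapping.single (us @ x # vs) c" "us @ x # vs \<in> words g n"
        unfolding multilin_gens_def by blast
      then have "basis w * p \<in> multilin_gens (m + n)"
      proof cases
        case 1
        then have "basis w * p = basis ((w @ us) @ (x \<oplus> y) # vs) - basis ((w @ us) @ x # vs) - basis ((w @ us) @ y # vs)"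
          by (simp add: right_diff_distrib mult_single plus_list_def)
        moreover have "(w @ us) @ x # vs \<in> words g (m + n)" "(w @ us) @ y # vs \<in> words g (m + n)"
          using 1 assms(2) by (auto simp: words_def)
        ultimately show ?thesis unfolding multilin_gens_def by blast
      next
        case 2
        then have "basis w * p = basis ((w @ us) @ (c \<odot> x) # vs) - Poly_Mapping.single ((w @ us) @ x # vs) c"
          by (simp add: right_diff_distrib mult_single plus_list_def)
        moreover have "(w @ us) @ x # vs \<in> words g (m + n)"
          using 2 assms(2) by (auto simp: words_def)
        ultimately show ?thesis unfolding multilin_gens_def by blast
      qed
      then show "p \<in> {p. basis w * p \<in> multilin_rel g (m + n)}"
        unfolding multilin_rel_span by (auto intro: pm.span_base)
    qed
  qed
  then show ?thesis using assms(1) multilin_rel_span by blast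
qed

lemma multilin_rel_mult_basis_right:
  assumes "p \<in> multilin_rel g n" "w \<in> words g m"
  shows "p * basis w \<in> multilin_rel g (n + m)"
proof -
  have "pm.span (multilin_gens n) \<subseteq> {p. p * basis w \<in> multilin_rel g (n + m)}"
  proof (rule pm.span_minimal)
    show "pm.subspace {p. p * basis w \<in> multilin_rel g (n + m)}"
      by (intro subspace_vimage[OF linear_mult_right[OF linear_id] subspace_multilin_rel])
    show "multilin_gens n \<subseteq> {p. p * basis w \<in> multilin_rel g (n + m)}"
    proof
      fix p assume "p \<in> multilin_gens n"
      then consider us x y vs where "p = basis (us @ (x \<oplus> y) # vs) - basis (us @ x # vs) - basis (us @ y # vs)"
           "us @ x # vs \<in> words g n" "us @ y # vs \<in> words g n"
        | us x c vs where "p = basis (us @ (c \<odot> x) # vs) - Poly_Mapping.single (us @ x # vs) c" "us @ x # vs \<in> words g n"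
        unfolding multilin_gens_def by blast
      then have "p * basis w \<in> multilin_gens (n + m)"
      proof cases
        case 1
        then have "p * basis w = basis (us @ (x \<oplus> y) # vs @ w) - basis (us @ x # vs @ w) - basis (us @ y # vs @ w)"
          by (simp add: left_diff_distrib mult_single plus_list_def)
        moreover have "us @ x # vs @ w \<in> words g (n + m)" "us @ y # vs @ w \<in> words g (n + m)"
          using 1 assms(2) by (auto simp: words_def)
        ultimately show ?thesis unfolding multilin_gens_def by blast
      next
        case 2
        then have "p * basis w = basis (us @ (c \<odot> x) # vs @ w) - Poly_Mapping.single (us @ x # vs @ w) c"
          by (simp add: left_diff_distrib mult_single plus_list_def)
        moreover have "us @ x # vs @ w \<in> words g (n + m)"
          using 2 assms(2) by (auto simp: words_def)
        ultimately show ?thesis unfolding multilin_gens_def by blast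
      qed
      then show "p \<in> {p. p * basis w \<in> multilin_rel g (n + m)}"
        unfolding multilin_rel_span by (auto intro: pm.span_base)
    qed
  qed
  then show ?thesis using assms(1) multilin_rel_span by blast
qed

lemma multilin_rel_mult_left:
  assumes "p \<in> multilin_rel g n" "q \<in> Wn m"
  shows "q * p \<in> multilin_rel g (m + n)"
  by (rule linear_subspaceI[OF linear_mult_right[OF linear_id] subspace_multilin_rel])
    (use assms in \<open>auto simp: mem_Wn intro: multilin_rel_mult_basis_left\<close>)

lemma multilin_rel_mult_right:
  assumes "p \<in> multilin_rel g n" "q \<in> Wn m"
  shows "p * q \<in> multilin_rel g (n + m)"
  by (rule linear_subspaceI[OF linear_mult_left[OF linear_id] subspace_multilin_rel])
    (use assms in \<open>auto simp: mem_Wn intro: multilin_rel_mult_basis_right\<close>)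

text \<open>The union in \<open>tensor_mult\<close> runs over all representatives. Since products
  with a relation are relations, they all give the same coset and the union collapses to it.\<close>

lemma tensor_mult_tcoset:
  assumes p: "p \<in> Wn i" and q: "q \<in> Wn j"
  shows "tensor_mult g i j (tcoset i p) (tcoset j q) = tcoset (i + j) (p * q)"
proof -
  have eq: "tcoset (i + j) (p' * q') = tcoset (i + j) (p * q)"
    if "p' \<in> tcoset i p" "q' \<in> tcoset j q" for p' q'
  proof -
    have p': "p' \<in> Wn i" "p' - p \<in> multilin_rel g i"
      using that p tp.mem_coset_iff[of p i p'] tcoset_eq_iff by (auto simp: mem_Wn)
    have q': "q' \<in> Wn j" "q' - q \<in> multilin_rel g j"
      using that q tp.mem_coset_iff[of q j q'] tcoset_eq_iff by (auto simp: mem_Wn)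
    have "p' * q' - p * q = (p' - p) * q' + p * (q' - q)"
      by (simp add: algebra_simps)
    also have "\<dots> \<in> multilin_rel g (i + j)"
      using p p' q' by (intro pm.subspace_add subspace_multilin_rel multilin_rel_mult_left multilin_rel_mult_right)
    finally show ?thesis
      using p p' q q' by (simp add: tcoset_eq_iff Wn_mult)
  qed
  have "p \<in> tcoset i p" "q \<in> tcoset j q"
    using p q by (auto simp: mem_Wn intro: tp.H.a_rcos_self)
  then show ?thesis
    unfolding tensor_mult_def bilin_ext_append using eq by blast
qed

lemma tensor_power_simps:
  "carrier (tensor_power g n) = tcoset n ` Wn n" "\<zero>\<^bsub>tensor_power g n\<^esub> = multilin_rel g n"
  unfolding tensor_power_def by (simp_all add: tp.quot_simps Wn_def)

lemma tensor_power_add: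
  "p \<in> Wn n \<Longrightarrow> q \<in> Wn n \<Longrightarrow> tcoset n p \<oplus>\<^bsub>tensor_power g n\<^esub> tcoset n q = tcoset n (p + q)"
  unfolding tensor_power_def using tp.quot_add[of p n q] by (simp add: mem_Wn)

lemma tensor_power_smult:
  "p \<in> Wn n \<Longrightarrow> c \<odot>\<^bsub>tensor_power g n\<^esub> tcoset n p = tcoset n (c *\<^sub>Q p)"
  unfolding tensor_power_def using tp.quot_smult[of p n c] by (simp add: mem_Wn)

lemma tcoset_zero: "tcoset n 0 = multilin_rel g n"
  using tp.coset_eq_self_iff[of 0 n] by (simp add: pm.subspace_0[OF subspace_multilin_rel])

lemma tensor_power_finsum:
  assumes "finite I" "\<And>i. i \<in> I \<Longrightarrow> f i \<in> Wn n"
  shows "(\<Oplus>\<^bsub>tensor_power g n\<^esub>i\<in>I. tcoset n (f i)) = tcoset n (\<Sum>i\<in>I. f i)"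
  using assms unfolding tensor_power_def by (subst tp.quot_finsum) (auto simp: finsum_free_mod mem_Wn)

lemma rat_module_tensor_power: "rat_module (tensor_power g n)"
  unfolding tensor_power_def by (rule tp.rat_module_quot)

section \<open>The tensor algebra as an image of the algebra of words\<close>

lemma cls_closed: "p \<in> W \<Longrightarrow> cls p \<in> carrier T"
proof -
  assume p: "p \<in> W"
  have "{n. cls p n \<noteq> \<zero>\<^bsub>tensor_power g n\<^esub>} \<subseteq> length ` Poly_Mapping.keys p"
  proof
    fix n assume "n \<in> {n. cls p n \<noteq> \<zero>\<^bsub>tensor_power g n\<^esub>}"
    then have "hcomp n p \<noteq> 0" by (auto simp: cls_def tensor_power_simps tcoset_zero)
    then obtain w where "w \<in> Poly_Mapping.keys (hcomp n p)"
      by (metis all_not_in_conv keys_eq_empty)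
    then show "n \<in> length ` Poly_Mapping.keys p" using keys_hcomp[of n p] by auto
  qed
  then have "finite {n. cls p n \<noteq> \<zero>\<^bsub>tensor_power g n\<^esub>}"
    by (rule finite_subset) simp
  then show ?thesis
    using hcomp_W[OF p] by (auto simp: tensor_algebra_def tensor_power_simps cls_def)
qed

text \<open>The third condition chooses a representative without words in the degrees where
  \<open>u\<close> vanishes. It turns the vanishing of components in \<open>uea_filt\<close> into a
  bound on the length of words.\<close>

lemma cls_surj:
  assumes u: "u \<in> carrier T"
  obtains p where "p \<in> W" "cls p = u" "\<And>w. w \<in> Poly_Mapping.keys p \<Longrightarrow> u (length w) \<noteq> \<zero>\<^bsub>tensor_power g (length w)\<^esub>"
proof -
  define N where "N = {n. u n \<noteq> \<zero>\<^bsub>tensor_power g n\<^esub>}"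
  have "finite N" using u by (simp add: tensor_algebra_def N_def)
  have "\<forall>n. \<exists>p\<in>Wn n. u n = tcoset n p"
    using u by (fastforce simp: tensor_algebra_def tensor_power_simps)
  then obtain r where r: "\<And>n. r n \<in> Wn n" "\<And>n. u n = tcoset n (r n)" by metis
  define p where "p = (\<Sum>n\<in>N. r n)"
  have keys: "Poly_Mapping.keys p \<subseteq> (\<Union>n\<in>N. Poly_Mapping.keys (r n))"
    unfolding p_def by (rule keys_sum)
  have "hcomp n p = (if n \<in> N then r n else 0)" for n
    using \<open>finite N\<close> by (auto simp: p_def hcomp_simps hcomp_Wn[OF r(1)] sum.delta)
  then have "cls p = u"
    by (rule_tac ext) (auto simp: cls_def r(2)[symmetric] tcoset_zero N_def tensor_power_simps)
  moreover have "p \<in> W" using keys r(1) by (force simp: words_def mem_W mem_Wn)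
  moreover have "u (length w) \<noteq> \<zero>\<^bsub>tensor_power g (length w)\<^esub>" if "w \<in> Poly_Mapping.keys p" for w
  proof -
    obtain n where "n \<in> N" "w \<in> Poly_Mapping.keys (r n)" using keys \<open>w \<in> _\<close> by blast
    then have "length w \<in> N" using r(1)[of n] by (auto simp: words_def mem_Wn)
    then show ?thesis by (simp add: N_def)
  qed
  ultimately show ?thesis using that by blast
qed

lemma carrier_T: "carrier T = cls ` W"
  using cls_surj cls_closed by blast

lemma cls_add: "p \<in> W \<Longrightarrow> q \<in> W \<Longrightarrow> cls p \<oplus>\<^bsub>T\<^esub> cls q = cls (p + q)"
  using hcomp_W by (simp add: tensor_algebra_def cls_def tensor_power_add hcomp_simps)

lemma cls_smult: "p \<in> W \<Longrightarrow> c \<odot>\<^bsub>T\<^esub> cls p = cls (c *\<^sub>Q p)"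
  using hcomp_W by (simp add: tensor_algebra_def cls_def tensor_power_smult hcomp_simps)

lemma cls_zero: "\<zero>\<^bsub>T\<^esub> = cls 0"
  by (simp add: tensor_algebra_def cls_def hcomp_simps tensor_power_simps tcoset_zero)

lemma in_degree_tcoset: "p \<in> Wn n \<Longrightarrow> in_degree g n (tcoset n p) = cls p"
  by (rule ext) (simp add: in_degree_def cls_def hcomp_Wn tcoset_zero tensor_power_simps)

lemma in_degree_pure:
  assumes "xs \<in> lists (carrier g)"
  shows "in_degree g (length xs) (pure_tensor g xs) = cls (basis xs)"
  unfolding pure_tensor_def by (rule in_degree_tcoset) (use assms in \<open>simp add: words_lists mem_Wn\<close>)

lemma cls_one: "\<one>\<^bsub>T\<^esub> = cls 1"
proof -
  have "basis ([] :: 'a list) = 1" by (metis single_one zero_list_def)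
  then show ?thesis using in_degree_pure[of "[]"] by (simp add: tensor_algebra_def)
qed

lemma cls_mult:
  assumes p: "p \<in> W" and q: "q \<in> W"
  shows "cls p \<otimes>\<^bsub>T\<^esub> cls q = cls (p * q)"
proof
  fix n
  interpret P: Module.module rat_ring "tensor_power g n" by (rule rat_module_tensor_power)
  have *: "hcomp i p * hcomp (n - i) q \<in> Wn n" if "i \<le> n" for i
    using Wn_mult[OF hcomp_W[OF p] hcomp_W[OF q], of i "n - i"] that by simp
  have "(cls p \<otimes>\<^bsub>T\<^esub> cls q) n =
      (\<Oplus>\<^bsub>tensor_power g n\<^esub>i\<in>{..n}. tensor_mult g i (n - i) (cls p i) (cls q (n - i)))"
    by (simp add: tensor_algebra_def)
  also have "\<dots> = (\<Oplus>\<^bsub>tensor_power g n\<^esub>i\<in>{..n}. tcoset n (hcomp i p * hcomp (n - i) q))"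
  proof (rule P.M.finsum_cong')
    fix i assume "i \<in> {..n}"
    then show "tensor_mult g i (n - i) (cls p i) (cls q (n - i)) = tcoset n (hcomp i p * hcomp (n - i) q)"
      using tensor_mult_tcoset[OF hcomp_W[OF p] hcomp_W[OF q], of i "n - i"] by (simp add: cls_def)
  qed (use * in \<open>auto simp: tensor_power_simps\<close>)
  also have "\<dots> = tcoset n (\<Sum>i\<in>{..n}. hcomp i p * hcomp (n - i) q)"
    by (rule tensor_power_finsum) (use * in auto)
  also have "\<dots> = cls (p * q) n" by (simp add: cls_def hcomp_mult)
  finally show "(cls p \<otimes>\<^bsub>T\<^esub> cls q) n = cls (p * q) n" .
qed

lemma cls_eq_iff:
  assumes "p \<in> W" "q \<in> W"
  shows "cls p = cls q \<longleftrightarrow> (\<forall>n. hcomp n (p - q) \<in> multilin_rel g n)"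
  using assms hcomp_W by (auto simp: cls_def fun_eq_iff tcoset_eq_iff hcomp_simps)

lemma rat_module_T: "rat_module T"
  by (rule rat_moduleI)
    (auto simp: carrier_T cls_add cls_smult cls_zero W_closed pm.scale_left_distrib
      pm.scale_right_distrib add_ac)

lemma ring_T: "ring T"
proof (rule ringI)
  show "abelian_group T"
    using rat_module_T by (simp add: Module.module_def)
  show "Group.monoid T"
    by (rule monoidI)
      (auto simp: carrier_T cls_mult cls_one W_closed one_W mult.assoc)
qed (auto simp: carrier_T cls_mult cls_add W_closed distrib_left distrib_right)

lemma cls_minus: "p \<in> W \<Longrightarrow> q \<in> W \<Longrightarrow> cls p \<ominus>\<^bsub>T\<^esub> cls q = cls (p - q)"
  using rat_module_smult_minus[OF rat_module_T cls_closed cls_closed, of p q]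
    cls_add[of p "- q"] pm.subspace_neg[OF subspace_W, of q]
  by (simp add: cls_smult W_closed)

end

section \<open>The enveloping algebra and its filtration\<close>

text \<open>A permutation is a chain of adjacent transpositions: the first letter of
  \<open>xs\<close> is located in \<open>ys\<close> and moved there step by step. The prefix
  \<open>ws\<close> stays free in the induction, so that a common first letter can be shifted into
  it; compatibility of \<open>R\<close> with prefixes is already built into
  \<open>swap\<close>.\<close>

lemma mset_eq_adjacent_swaps:
  assumes refl: "\<And>xs. R xs xs" and trans: "\<And>xs ys zs. R xs ys \<Longrightarrow> R ys zs \<Longrightarrow> R xs zs"
    and swap: "\<And>us x y vs. R (us @ x # y # vs) (us @ y # x # vs)"
    and "mset xs = mset ys"
  shows "R (ws @ xs) (ws @ ys)"
  using assms(4)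
proof (induction xs arbitrary: ws ys)
  case Nil
  then show ?case by (simp add: refl)
next
  case (Cons x xs)
  then have "x \<in> set ys" by (metis list.set_intros(1) mset_eq_setD)
  then obtain us vs where ys: "ys = us @ x # vs" by (meson split_list)
  then have "mset xs = mset (us @ vs)" using Cons.prems by simp
  then have 1: "R (ws @ x # xs) (ws @ x # us @ vs)"
    using Cons.IH[of "us @ vs" "ws @ [x]"] by simp
  have 2: "R (ws @ x # us @ vs) (ws @ us @ x # vs)" for ws
  proof (induction us arbitrary: ws)
    case Nil
    then show ?case by (simp add: refl)
  next
    case (Cons u us)
    have "R (ws @ u # x # us @ vs) (ws @ u # us @ x # vs)"
      using Cons[of "ws @ [u]"] by simp
    with swap[of ws x u "us @ vs"] show ?case by (auto intro: trans)
  qed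
  show ?case using trans[OF 1 2] ys by simp
qed

locale lie_mod = rat_mod +
  assumes bracket_closed: "x \<in> carrier g \<Longrightarrow> y \<in> carrier g \<Longrightarrow> x \<otimes> y \<in> carrier g"
begin

abbreviation J where "J \<equiv> uea_ideal g"

definition lie_rel :: "'a \<Rightarrow> 'a \<Rightarrow> 'a list \<Rightarrow>\<^sub>0 rat" where
  "lie_rel x y = basis [x, y] - basis [y, x] - basis [x \<otimes> y]"

lemma basis_W: "xs \<in> lists (carrier g) \<Longrightarrow> basis xs \<in> W"
  by (simp add: mem_W)

lemma lie_rel_W: "x \<in> carrier g \<Longrightarrow> y \<in> carrier g \<Longrightarrow> lie_rel x y \<in> W"
  unfolding lie_rel_def by (intro pm.subspace_diff subspace_W basis_W) (auto intro: bracket_closed)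

lemma tensor_incl_cls: "x \<in> carrier g \<Longrightarrow> tensor_incl g x = cls (basis [x])"
  using in_degree_pure[of "[x]"] by (simp add: tensor_incl_def)

lemma uea_ideal_cls: "J = genideal T {cls (lie_rel x y) | x y. x \<in> carrier g \<and> y \<in> carrier g}"
proof -
  have *: "(tensor_incl g x \<otimes>\<^bsub>T\<^esub> tensor_incl g y) \<ominus>\<^bsub>T\<^esub> (tensor_incl g y \<otimes>\<^bsub>T\<^esub> tensor_incl g x)
        \<ominus>\<^bsub>T\<^esub> tensor_incl g (x \<otimes> y) = cls (lie_rel x y)" if "x \<in> carrier g" "y \<in> carrier g" for x y
    using that
    by (simp add: tensor_incl_cls bracket_closed cls_mult cls_minus W_closed basis_W lie_rel_def
        mult_single plus_list_def)
  then show ?thesis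
    unfolding uea_ideal_def
    by (intro arg_cong[of _ _ "genideal T"] Collect_cong iff_exI) (simp add: * cong: rev_conj_cong)
qed

lemma ideal_J: "ideal J T"
  unfolding uea_ideal_cls
  by (rule ring.genideal_ideal[OF ring_T]) (auto intro!: cls_closed lie_rel_W)

sublocale J: ideal J T by (rule ideal_J)

lemma lie_rel_J: "x \<in> carrier g \<Longrightarrow> y \<in> carrier g \<Longrightarrow> cls (lie_rel x y) \<in> J"
  unfolding uea_ideal_cls
  by (rule subsetD[OF ring.genideal_self[OF ring_T]]) (auto intro!: cls_closed lie_rel_W)

lemma J_minimal:
  assumes "ideal I T" "\<And>x y. x \<in> carrier g \<Longrightarrow> y \<in> carrier g \<Longrightarrow> cls (lie_rel x y) \<in> I"
  shows "J \<subseteq> I"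
  unfolding uea_ideal_cls by (rule ring.genideal_minimal[OF ring_T assms(1)]) (use assms(2) in auto)

lemma J_mult:
  assumes "cls p \<in> J" "p \<in> W" "q \<in> W" "r \<in> W"
  shows "cls (q * p * r) \<in> J"
  using J.I_r_closed[OF J.I_l_closed[OF assms(1) cls_closed] cls_closed, of q r] assms
  by (simp add: cls_mult W_closed)

sublocale uq: rat_submodule T J
proof (intro rat_submodule.intro rat_submodule_axioms.intro rat_module_T)
  have "c \<odot>\<^bsub>T\<^esub> u \<in> J" if u: "u \<in> J" for c u
  proof -
    from u obtain p where p: "p \<in> W" "u = cls p" using carrier_T J.a_Hcarr by blast
    \<comment> \<open>\<open>genideal\<close> yields a ring ideal, which knows nothing of scalars.
      Closure under scaling follows because c u is the product of u with the element c 1 of the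
      algebra.\<close>
    then have "cls ((c *\<^sub>Q 1) * p * 1) \<in> J"
      using u by (intro J_mult W_closed one_W) auto
    then show ?thesis using p by (simp add: pscale_mult_left cls_smult)
  qed
  then show "submodule J rat_ring T"
    unfolding submodule_rat_iff[OF rat_module_T] using J.a_subset by auto
qed

section \<open>The enveloping algebra and its filtration on representatives\<close>

definition pr :: "('a list \<Rightarrow>\<^sub>0 rat) \<Rightarrow> (nat \<Rightarrow> ('a list \<Rightarrow>\<^sub>0 rat) set) set" where
  "pr p = uea_proj g (cls p)"

lemma carrier_uea: "carrier (uea g) = pr ` W"
  by (auto simp: uea_def uq.quot_simps carrier_T pr_def uea_proj_def)

lemma pr_add: "p \<in> W \<Longrightarrow> q \<in> W \<Longrightarrow> pr p \<oplus>\<^bsub>uea g\<^esub> pr q = pr (p + q)"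
  by (simp add: uea_def pr_def uea_proj_def uq.quot_add cls_closed cls_add)

lemma pr_smult: "p \<in> W \<Longrightarrow> c \<odot>\<^bsub>uea g\<^esub> pr p = pr (c *\<^sub>Q p)"
  by (simp add: uea_def pr_def uea_proj_def uq.quot_smult cls_closed cls_smult)

lemma pr_zero: "\<zero>\<^bsub>uea g\<^esub> = pr 0"
  using uq.quot_zero_eq by (simp add: uea_def pr_def uea_proj_def cls_zero)

lemma rat_module_uea: "rat_module (uea g)"
  unfolding uea_def by (rule uq.rat_module_quot)

lemma pr_eq_iff: "p \<in> W \<Longrightarrow> q \<in> W \<Longrightarrow> pr p = pr q \<longleftrightarrow> cls (p - q) \<in> J"
  by (simp add: pr_def uea_proj_def uq.coset_eq_iff cls_closed cls_minus)

text \<open>The bound is an integer as in \<open>uea_filt\<close>: for \<open>k = - 1\<close> no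
  word qualifies and only 0 remains, so degree \<open>n = 0\<close> fits the same formulas.\<close>

definition Wf :: "int \<Rightarrow> ('a list \<Rightarrow>\<^sub>0 rat) set" where
  "Wf k = {p. Poly_Mapping.keys p \<subseteq> {w \<in> lists (carrier g). int (length w) \<le> k}}"

lemma subspace_Wf: "pm.subspace (Wf k)"
  unfolding Wf_def by (rule subspace_keys)

lemma Wf_W: "p \<in> Wf k \<Longrightarrow> p \<in> W"
  by (auto simp: Wf_def mem_W)

lemma Wf_mono: "k \<le> l \<Longrightarrow> Wf k \<subseteq> Wf l"
  by (fastforce simp: Wf_def)

lemma uea_filt_pr: "uea_filt g k = pr ` Wf k"
proof
  show "uea_filt g k \<subseteq> pr ` Wf k"
  proof
    fix X assume "X \<in> uea_filt g k"
    then obtain u where u: "u \<in> carrier T" "\<And>j. int j > k \<Longrightarrow> u j = \<zero>\<^bsub>tensor_power g j\<^esub>" "X = uea_proj g u"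
      by (auto simp: uea_filt_def)
    obtain p where p: "p \<in> W" "cls p = u"
      "\<And>w. w \<in> Poly_Mapping.keys p \<Longrightarrow> u (length w) \<noteq> \<zero>\<^bsub>tensor_power g (length w)\<^esub>"
      using cls_surj[OF u(1)] by blast
    then have "p \<in> Wf k" using u(2) by (fastforce simp: Wf_def mem_W)
    then show "X \<in> pr ` Wf k" using p u by (auto simp: pr_def)
  qed
  show "pr ` Wf k \<subseteq> uea_filt g k"
  proof
    fix X assume "X \<in> pr ` Wf k"
    then obtain p where p: "p \<in> Wf k" "X = pr p" by auto
    have "cls p j = \<zero>\<^bsub>tensor_power g j\<^esub>" if "int j > k" for j
    proof -
      have "Poly_Mapping.keys (hcomp j p) = {}"
        using keys_hcomp[of j p] p that by (fastforce simp: Wf_def)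
      then show ?thesis by (simp add: cls_def tensor_power_simps tcoset_zero)
    qed
    then show "X \<in> uea_filt g k"
      using p cls_closed[OF Wf_W[OF p(1)]] by (auto simp: uea_filt_def pr_def)
  qed
qed

lemma submodule_uea_filt: "submodule (uea_filt g k) rat_ring (uea g)"
  unfolding submodule_rat_iff[OF rat_module_uea]
proof (intro conjI ballI allI)
  show "uea_filt g k \<subseteq> carrier (uea g)"
    by (auto simp: uea_filt_pr carrier_uea intro: Wf_W)
  show "\<zero>\<^bsub>uea g\<^esub> \<in> uea_filt g k"
    by (auto simp: uea_filt_pr pr_zero intro: pm.subspace_0 subspace_Wf)
  fix x assume "x \<in> uea_filt g k"
  then obtain p where p: "p \<in> Wf k" "x = pr p" by (auto simp: uea_filt_pr)
  fix c show "c \<odot>\<^bsub>uea g\<^esub> x \<in> uea_filt g k"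
    using p by (auto simp: uea_filt_pr pr_smult Wf_W intro: pm.subspace_scale subspace_Wf)
  fix y assume "y \<in> uea_filt g k"
  then obtain q where q: "q \<in> Wf k" "y = pr q" by (auto simp: uea_filt_pr)
  show "x \<oplus>\<^bsub>uea g\<^esub> y \<in> uea_filt g k"
    using p q by (auto simp: uea_filt_pr pr_add Wf_W intro: pm.subspace_add subspace_Wf)
qed

abbreviation U :: "nat \<Rightarrow> (rat, (nat \<Rightarrow> ('a list \<Rightarrow>\<^sub>0 rat) set) set) module" where
  "U n \<equiv> (uea g)\<lparr>carrier := uea_filt g (int n)\<rparr>"

sublocale gr: rat_submodule "U n" "uea_filt g (int n - 1)" for n
proof (intro rat_submodule.intro rat_submodule_axioms.intro)
  show U: "rat_module (U n)"
    by (rule submodule.submodule_is_module[OF submodule_uea_filt rat_module_uea])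
  have "uea_filt g (int n - 1) \<subseteq> uea_filt g (int n)"
    unfolding uea_filt_pr by (intro image_mono Wf_mono) simp
  then show "submodule (uea_filt g (int n - 1)) rat_ring (U n)"
    using submodule_uea_filt[of "int n - 1"]
    unfolding submodule_rat_iff[OF U] submodule_rat_iff[OF rat_module_uea] by simp
qed

text \<open>\<open>pbw_map\<close> forms cosets in \<open>uea g\<close>, while \<open>uea_gr\<close>
  forms them in the record with the smaller carrier. A coset depends on the addition only.\<close>

lemma uea_coset: "C +>\<^bsub>U n\<^esub> X = C +>\<^bsub>uea g\<^esub> X"
  by (simp add: a_r_coset_def')

lemma pr_coset_eq_zero_iff:
  assumes "p \<in> Wf (int n)"
  shows "uea_filt g (int n - 1) +>\<^bsub>U n\<^esub> pr p = uea_filt g (int n - 1) \<longleftrightarrow>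
    (\<exists>q\<in>Wf (int n - 1). cls (p - q) \<in> J)"
proof -
  have "uea_filt g (int n - 1) +>\<^bsub>U n\<^esub> pr p = uea_filt g (int n - 1) \<longleftrightarrow> pr p \<in> uea_filt g (int n - 1)"
    using assms by (intro gr.coset_eq_self_iff) (auto simp: uea_filt_pr)
  also have "\<dots> \<longleftrightarrow> (\<exists>q\<in>Wf (int n - 1). cls (p - q) \<in> J)"
    using assms by (auto simp: uea_filt_pr image_iff pr_eq_iff Wf_W)
  finally show ?thesis .
qed

text \<open>Modulo \<open>J\<close>, swapping two neighbours x, y changes a product by the word with
  the single letter [x, y] in their place, which is shorter by one and hence lies in the lower step
  of the filtration.\<close>

lemma perm_filt:
  assumes "xs \<in> words g n" "mset xs = mset ys"
  shows "pr (basis xs - basis ys) \<in> uea_filt g (int n - 1)"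
proof -
  \<comment> \<open>Membership in \<open>words g n\<close> travels along with the congruence, so
    that every intermediate word in the chain of swaps is known to have its letters in
    \<open>g\<close>.\<close>
  define R where "R = (\<lambda>xs ys. xs \<in> words g n \<longrightarrow> ys \<in> words g n \<and>
    pr (basis xs - basis ys) \<in> uea_filt g (int n - 1))"
  have "R ([] @ xs) ([] @ ys)"
  proof (rule mset_eq_adjacent_swaps)
    show "R xs xs" for xs
      using submodule_uea_filt[of "int n - 1"]
      by (auto simp: R_def submodule_rat_iff[OF rat_module_uea] pr_zero)
  next
    fix xs ys zs assume 1: "R xs ys" "R ys zs"
    show "R xs zs" unfolding R_def
    proof
      assume xs: "xs \<in> words g n"
      have W: "basis xs - basis ys \<in> W" "basis ys - basis zs \<in> W"
        using 1 xs by (auto simp: R_def words_lists intro!: pm.subspace_diff subspace_W basis_W)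
      have "pr (basis xs - basis ys) \<oplus>\<^bsub>uea g\<^esub> pr (basis ys - basis zs) \<in> uea_filt g (int n - 1)"
        using submodule_uea_filt[of "int n - 1"] 1 xs
        by (auto simp: R_def submodule_rat_iff[OF rat_module_uea])
      then show "zs \<in> words g n \<and> pr (basis xs - basis zs) \<in> uea_filt g (int n - 1)"
        using 1 xs W by (auto simp: R_def pr_add)
    qed
  next
    fix us x y vs
    show "R (us @ x # y # vs) (us @ y # x # vs)" unfolding R_def
    proof
      assume w: "us @ x # y # vs \<in> words g n"
      then have c: "x \<in> carrier g" "y \<in> carrier g" "us \<in> lists (carrier g)" "vs \<in> lists (carrier g)"
        by (auto simp: words_lists)
      have "cls (basis us * lie_rel x y * basis vs) \<in> J"
        using c by (intro J_mult lie_rel_J lie_rel_W basis_W)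
      moreover have "basis us * lie_rel x y * basis vs =
         (basis (us @ x # y # vs) - basis (us @ y # x # vs)) - basis (us @ (x \<otimes> y) # vs)"
        by (simp add: lie_rel_def algebra_simps mult_single plus_list_def)
      moreover have "basis (us @ (x \<otimes> y) # vs) \<in> Wf (int n - 1)"
        using c w by (auto simp: Wf_def words_lists bracket_closed)
      moreover have "basis (us @ x # y # vs) - basis (us @ y # x # vs) \<in> W"
        using c by (intro pm.subspace_diff subspace_W basis_W) auto
      ultimately have "pr (basis (us @ x # y # vs) - basis (us @ y # x # vs)) \<in> uea_filt g (int n - 1)"
        unfolding uea_filt_pr using pr_eq_iff Wf_W by (metis image_eqI)
      then show "us @ y # x # vs \<in> words g n \<and>
          pr (basis (us @ x # y # vs) - basis (us @ y # x # vs)) \<in> uea_filt g (int n - 1)"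
        using w by (auto simp: words_def)
    qed
  qed (rule assms)
  then show ?thesis using assms by (simp add: R_def)
qed

section \<open>Symmetric powers and reduction of the theorem to injectivity\<close>

lemma pure_tensor_tcoset: "xs \<in> words g n \<Longrightarrow> pure_tensor g xs = tcoset n (basis xs)"
  by (simp add: pure_tensor_def words_def)

lemma sym_gen_tcoset:
  assumes "xs \<in> words g n" "ys \<in> words g n"
  shows "pure_tensor g xs \<ominus>\<^bsub>tensor_power g n\<^esub> pure_tensor g ys = tcoset n (basis xs - basis ys)"
  using assms tp.quot_minus[of "basis xs" n "basis ys"]
  by (simp add: pure_tensor_tcoset free_mod_minus tensor_power_def)

sublocale sym: rat_submodule "tensor_power g n" "sym_rel g n" for n
proof (intro rat_submodule.intro rat_submodule_axioms.intro rat_module_tensor_power)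
  show "submodule (sym_rel g n) rat_ring (tensor_power g n)"
    unfolding sym_rel_def
    by (rule lin_span_submodule[OF rat_module_tensor_power])
      (auto simp: sym_gen_tcoset tensor_power_simps mem_Wn intro!: imageI pm.subspace_diff[OF subspace_Wn])
qed

lemma Wn_Wf: "p \<in> Wn n \<Longrightarrow> p \<in> Wf (int n)"
  by (auto simp: mem_Wn Wf_def words_def)

text \<open>Needed for the PBW map to be well defined. The cosets with such a representative form a
  submodule, and by \<open>perm_filt\<close> it contains the generators of
  \<open>sym_rel\<close>.\<close>

lemma sym_rel_filt:
  assumes "C \<in> sym_rel g n"
  shows "\<exists>p\<in>Wn n. C = tcoset n p \<and> pr p \<in> uea_filt g (int n - 1)"
proof -
  let ?H = "{tcoset n p | p. p \<in> Wn n \<and> pr p \<in> uea_filt g (int n - 1)}"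
  note sub = submodule_uea_filt[of "int n - 1", unfolded submodule_rat_iff[OF rat_module_uea]]
  have "sym_rel g n \<subseteq> ?H" unfolding sym_rel_def
  proof (rule lin_span_minimal)
    show "submodule ?H rat_ring (tensor_power g n)"
      unfolding submodule_rat_iff[OF rat_module_tensor_power]
    proof (intro conjI ballI allI)
      show "?H \<subseteq> carrier (tensor_power g n)" by (auto simp: tensor_power_simps)
      show "\<zero>\<^bsub>tensor_power g n\<^esub> \<in> ?H"
        using sub tcoset_zero pm.subspace_0[OF subspace_Wn] by (auto simp: tensor_power_simps pr_zero)
      fix x assume "x \<in> ?H"
      then obtain p where p: "p \<in> Wn n" "pr p \<in> uea_filt g (int n - 1)" "x = tcoset n p" by auto
      fix c
      have "pr (c *\<^sub>Q p) \<in> uea_filt g (int n - 1)"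
        using sub p pr_smult[OF Wn_subset] by metis
      then show "c \<odot>\<^bsub>tensor_power g n\<^esub> x \<in> ?H"
        using p pm.subspace_scale[OF subspace_Wn] by (auto simp: tensor_power_smult)
      fix y assume "y \<in> ?H"
      then obtain q where q: "q \<in> Wn n" "pr q \<in> uea_filt g (int n - 1)" "y = tcoset n q" by auto
      have "pr (p + q) \<in> uea_filt g (int n - 1)"
        using sub p q pr_add[OF Wn_subset Wn_subset] by metis
      then show "x \<oplus>\<^bsub>tensor_power g n\<^esub> y \<in> ?H"
        using p q pm.subspace_add[OF subspace_Wn] by (auto simp: tensor_power_add)
    qed
    show "{pure_tensor g xs \<ominus>\<^bsub>tensor_power g n\<^esub> pure_tensor g ys | xs ys.
        xs \<in> words g n \<and> ys \<in> words g n \<and> mset xs = mset ys} \<subseteq> ?H"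
    proof
      fix X assume "X \<in> {pure_tensor g xs \<ominus>\<^bsub>tensor_power g n\<^esub> pure_tensor g ys | xs ys.
        xs \<in> words g n \<and> ys \<in> words g n \<and> mset xs = mset ys}"
      then obtain xs ys where xs: "xs \<in> words g n" "ys \<in> words g n" "mset xs = mset ys"
        "X = tcoset n (basis xs - basis ys)" by (auto simp: sym_gen_tcoset)
      moreover have "basis xs - basis ys \<in> Wn n"
        using xs by (intro pm.subspace_diff subspace_Wn) (auto simp: mem_Wn)
      ultimately show "X \<in> ?H" using perm_filt[of xs n ys] by auto
    qed
  qed
  then show ?thesis using assms by auto
qed

lemma Wf_minus_hcomp:
  assumes "q \<in> Wf (int n)"
  shows "q - hcomp n q \<in> Wf (int n - 1)"
proof -
  have "linear_pm (\<lambda>q. q - hcomp n q)"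
    by (intro linear_diff linear_id linear_hcomp)
  then show ?thesis
    by (rule linear_subspaceI[OF _ subspace_Wf])
      (use assms in \<open>auto simp: hcomp_single Wf_def\<close>)
qed

text \<open>Well-definedness comes from \<open>sym_rel_filt\<close> and surjectivity from dropping
  short words. What remains is injectivity, stated as \<open>inj\<close> on representatives: if a
  homogeneous \<open>p\<close> agrees in the enveloping algebra with a combination of shorter words,
  its tensor must be a symmetry relation.\<close>

theorem pbw_criterion:
  assumes inj: "\<And>p q. p \<in> Wn n \<Longrightarrow> q \<in> Wf (int n - 1) \<Longrightarrow> cls (p - q) \<in> J \<Longrightarrow> tcoset n p \<in> sym_rel g n"
  shows "pbw_map g n \<in> lin_iso (sym_power g n) (uea_gr g n)"
proof -
  let ?F = "uea_filt g (int n - 1)"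
  define f where "f = (\<lambda>C. ?F +>\<^bsub>uea g\<^esub> uea_proj g (in_degree g n C))"
  have f: "f (tcoset n p) = ?F +>\<^bsub>U n\<^esub> pr p" if "p \<in> Wn n" for p
    using that by (simp add: f_def in_degree_tcoset pr_def uea_coset)
  have pr_U: "pr p \<in> carrier (U n)" if "p \<in> Wn n" for p
    using that Wn_Wf by (auto simp: uea_filt_pr)
  have "(\<lambda>S. the_elem (f ` S)) \<in> lin_iso (quot_mod (tensor_power g n) (sym_rel g n)) (uea_gr g n)"
    unfolding uea_gr_def
  proof (rule sym.induced_lin_iso)
    show "rat_module (quot_mod (U n) ?F)" by (rule gr.rat_module_quot)
  next
    fix C assume "C \<in> carrier (tensor_power g n)"
    then obtain p where p: "p \<in> Wn n" "C = tcoset n p" by (auto simp: tensor_power_simps)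
    show "f C \<in> carrier (quot_mod (U n) ?F)"
      using p pr_U by (auto simp: f intro: gr.coset_carrier)
    have "pr p \<oplus>\<^bsub>U n\<^esub> pr q = pr (p + q)" if "q \<in> Wn n" for q
      using p that by (simp add: pr_add Wn_subset)
    show "f (c \<odot>\<^bsub>tensor_power g n\<^esub> C) = c \<odot>\<^bsub>quot_mod (U n) ?F\<^esub> f C" for c
      using p gr.quot_smult[OF pr_U, of p c]
      by (simp add: tensor_power_smult f pm.subspace_scale[OF subspace_Wn] pr_smult Wn_subset)
    show "f C = \<zero>\<^bsub>quot_mod (U n) ?F\<^esub> \<longleftrightarrow> C \<in> sym_rel g n"
    proof
      assume "f C = \<zero>\<^bsub>quot_mod (U n) ?F\<^esub>"
      then have "\<exists>q\<in>Wf (int n - 1). cls (p - q) \<in> J"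
        using p pr_coset_eq_zero_iff[OF Wn_Wf] by (simp add: gr.quot_simps f)
      then show "C \<in> sym_rel g n" using inj p by blast
    next
      assume "C \<in> sym_rel g n"
      then obtain p where "p \<in> Wn n" "C = tcoset n p" "pr p \<in> ?F" using sym_rel_filt by blast
      then show "f C = \<zero>\<^bsub>quot_mod (U n) ?F\<^esub>"
        using gr.coset_eq_self_iff[OF pr_U] by (simp add: gr.quot_simps f)
    qed
    fix D assume "D \<in> carrier (tensor_power g n)"
    then obtain q where q: "q \<in> Wn n" "D = tcoset n q" by (auto simp: tensor_power_simps)
    show "f (C \<oplus>\<^bsub>tensor_power g n\<^esub> D) = f C \<oplus>\<^bsub>quot_mod (U n) ?F\<^esub> f D"
      using p q gr.quot_add[OF pr_U pr_U, of p q]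
      by (simp add: tensor_power_add f pm.subspace_add[OF subspace_Wn] pr_add Wn_subset)
  next
    fix Y assume "Y \<in> carrier (quot_mod (U n) ?F)"
    then obtain X where "X \<in> uea_filt g (int n)" "Y = ?F +>\<^bsub>U n\<^esub> X"
      by (auto simp: gr.quot_simps)
    then obtain q where q: "q \<in> Wf (int n)" "Y = ?F +>\<^bsub>U n\<^esub> pr q"
      by (auto simp: uea_filt_pr)
    \<comment> \<open>The words of \<open>q\<close> shorter than \<open>n\<close> lie in the lower
      step of the filtration, so the top component alone represents the same class.\<close>
    let ?p = "hcomp n q"
    have p: "?p \<in> Wn n" using q by (intro hcomp_W Wf_W)
    have "pr (q - ?p) \<in> ?F"
      using Wf_minus_hcomp[OF q(1)] by (auto simp: uea_filt_pr)
    moreover have "pr q = pr (q - ?p) \<oplus>\<^bsub>U n\<^esub> pr ?p"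
      using Wf_W[OF Wf_minus_hcomp[OF q(1)]] p Wn_subset by (simp add: pr_add)
    ultimately have "pr q \<in> ?F +>\<^bsub>U n\<^esub> pr ?p"
      by (auto simp: a_r_coset_def')
    then have "f (tcoset n ?p) = Y"
      using q(2) pr_U[OF p] p by (simp add: f gr.mem_coset_iff)
    then show "\<exists>C\<in>carrier (tensor_power g n). f C = Y"
      using p by (auto simp: tensor_power_simps)
  qed
  then show ?thesis by (simp add: sym_power_def pbw_map_def[abs_def] f_def)
qed

end

section \<open>Splitting primitive elements of the free associative algebra\<close>

lemma lin_mult:
  fixes f :: "'l list \<Rightarrow> 'b::monoid_add \<Rightarrow>\<^sub>0 rat"
  assumes "\<And>u v. f (u @ v) = f u * f v"
  shows "lin f (p * q) = lin f p * lin f q"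
proof (rule linear_eqI[of "\<lambda>p. lin f (p * q)"])
  fix u
  show "lin f (basis u * q) = lin f (basis u) * lin f q"
  proof (rule linear_eqI[of "\<lambda>q. lin f (basis u * q)"])
    fix v
    show "lin f (basis u * basis v) = lin f (basis u) * lin f (basis v)"
      by (simp add: mult_single plus_list_def assms)
  qed (intro linear_intros linear_mult_intros)+
qed (intro linear_intros linear_mult_intros)+

lemma basis_Nil: "basis [] = 1"
  by (metis single_one zero_list_def)

lemma lin_one: "lin f (1 :: 'l list \<Rightarrow>\<^sub>0 rat) = f []"
  by (simp flip: basis_Nil)

text \<open>The unshuffles of a list: all pairs of complementary subsequences. A list is used, not a
  set, because repeated letters can give equal pairs, which must be counted separately.\<close>

fun splits :: "'a list \<Rightarrow> ('a list \<times> 'a list) list" where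
  "splits [] = [([], [])]"
| "splits (x # xs) = map (\<lambda>(A, B). (x # A, B)) (splits xs) @ map (\<lambda>(A, B). (A, x # B)) (splits xs)"

lemma splits_mset: "(A, B) \<in> set (splits xs) \<Longrightarrow> mset xs = mset A + mset B"
  by (induction xs arbitrary: A B) auto

lemma splits_Nil_count: "(\<Sum>(A, B)\<leftarrow>splits xs. if A = [] then 1 else 0 :: rat) = 1"
  by (induction xs) (simp_all add: case_prod_unfold comp_def)

text \<open>Source of the factorial: this count is what \<open>1 / of_nat (Suc n)\<close> cancels in
  the recursion of \<open>\<Phi>\<close>.\<close>

lemma splits_singleton_count: "(\<Sum>(A, B)\<leftarrow>splits xs. if length A = 1 then 1 else 0 :: rat) = of_nat (length xs)"
proof (induction xs)
  case (Cons x xs)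
  have "(\<Sum>(A, B)\<leftarrow>splits (x # xs). if length A = 1 then 1 else 0 :: rat) =
     (\<Sum>(A, B)\<leftarrow>splits xs. if A = [] then 1 else 0) + (\<Sum>(A, B)\<leftarrow>splits xs. if length A = 1 then 1 else 0)"
    by (simp add: case_prod_unfold comp_def)
  then show ?case using Cons splits_Nil_count[of xs] by simp
qed simp

text \<open>Expand by choosing one summand in each factor. Every \<open>f x\<close> commutes with
  every \<open>h y\<close>, so the chosen factors can be sorted into two products, each keeping its
  original order.\<close>

lemma prod_list_add_splits:
  fixes f h :: "'a \<Rightarrow> 'b::ring_1"
  assumes "\<And>x y. f x * h y = h y * f x"
  shows "prod_list (map (\<lambda>x. f x + h x) xs) =
    (\<Sum>(A, B)\<leftarrow>splits xs. prod_list (map f A) * prod_list (map h B))"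
proof (induction xs)
  case (Cons x xs)
  have comm: "h x * prod_list (map f A) = prod_list (map f A) * h x" for A
  proof (induction A)
    case (Cons a A)
    have "h x * (f a * prod_list (map f A)) = f a * (h x * prod_list (map f A))"
      by (metis assms mult.assoc)
    then show ?case by (simp add: Cons mult.assoc)
  qed simp
  have "prod_list (map f A) * (h x * Q) = h x * (prod_list (map f A) * Q)" for A Q
    by (metis comm mult.assoc)
  then show ?case
    by (simp add: Cons distrib_right sum_list_const_mult[symmetric] sum_list_addf case_prod_unfold comp_def mult.assoc)
qed simp

text \<open>The tensor square of the free algebra is encoded as the monoid algebra of pairs of
  words, multiplied componentwise. Thus \<open>inl p\<close> is p \<otimes> 1, \<open>inr q\<close>
  is 1 \<otimes> q, and by \<open>inl_inr\<close> these commute with product p \<otimes> q.\<close>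

abbreviation inl :: "('l list \<Rightarrow>\<^sub>0 rat) \<Rightarrow> 'l list \<times> 'l list \<Rightarrow>\<^sub>0 rat" where
  "inl \<equiv> lin (\<lambda>u. basis (u, []))"

abbreviation inr :: "('l list \<Rightarrow>\<^sub>0 rat) \<Rightarrow> 'l list \<times> 'l list \<Rightarrow>\<^sub>0 rat" where
  "inr \<equiv> lin (\<lambda>v. basis ([], v))"

lemma inl_inr: "inl p * inr q = bilin_ext Pair p q" "inr q * inl p = bilin_ext Pair p q"
  by (rule bilin_ext_eqI, (intro linear_mult_intros linear_intros)+,
      simp add: mult_single plus_prod_def plus_list_def)+

lemma inl_mult: "inl (p * q) = inl p * inl q" and inr_mult: "inr (p * q) = inr p * inr q"
  by (rule lin_mult; simp add: mult_single plus_prod_def plus_list_def)+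

lemma pair_one: "basis ([], []) = 1"
  by (metis single_one zero_list_def zero_prod_def)

lemma inl_prod_list: "inl (prod_list ps) = prod_list (map inl ps)"
  and inr_prod_list: "inr (prod_list ps) = prod_list (map inr ps)"
  by (induction ps) (simp_all add: inl_mult inr_mult lin_one pair_one)

text \<open>The unshuffle coproduct, given as the algebra homomorphism for which every letter is
  primitive.\<close>

definition coprod :: "('l list \<Rightarrow>\<^sub>0 rat) \<Rightarrow> 'l list \<times> 'l list \<Rightarrow>\<^sub>0 rat" where
  "coprod = lin (\<lambda>w. prod_list (map (\<lambda>a. basis ([a], []) + basis ([], [a])) w))"

lemma linear_coprod: "linear_pm coprod"
  unfolding coprod_def by (rule linear_lin)

lemma coprod_mult: "coprod (p * q) = coprod p * coprod q"
  unfolding coprod_def by (rule lin_mult) simp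

lemma coprod_prod_list: "coprod (prod_list ps) = prod_list (map coprod ps)"
  by (induction ps) (simp_all add: coprod_mult, simp add: coprod_def lin_one)

lemma coprod_letter: "coprod (basis [a]) = inl (basis [a]) + inr (basis [a])"
  by (simp add: coprod_def)

definition primitive :: "('l list \<Rightarrow>\<^sub>0 rat) \<Rightarrow> bool" where
  "primitive p \<longleftrightarrow> coprod p = inl p + inr p"

text \<open>In the commutator of the two coproducts the mixed terms cancel, because
  \<open>inl\<close> and \<open>inr\<close> have commuting images.\<close>

lemma primitive_commutator:
  assumes "primitive p" "primitive q"
  shows "primitive (p * q - q * p)"
proof -
  have "inr r * inl s = inl s * inr r" for r s :: "'a list \<Rightarrow>\<^sub>0 rat"
    by (simp add: inl_inr)
  then show ?thesis
    using assms unfolding primitive_def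
    by (simp add: linear_pmD[OF linear_coprod] coprod_mult inl_mult inr_mult lin_simps algebra_simps)
qed

lemma subspace_primitive: "pm.subspace {p. primitive p}"
  by (rule pm.subspaceI) (simp_all add: primitive_def coprod_def lin_simps pm.scale_right_distrib)

lemma subspace_sum_list_cong:
  assumes "pm.subspace H" "\<And>x. x \<in> set xs \<Longrightarrow> f x - h x \<in> H"
  shows "(\<Sum>x\<leftarrow>xs. f x) - (\<Sum>x\<leftarrow>xs. h x) \<in> H"
  using assms(2)
proof (induction xs)
  case Nil
  then show ?case by (simp add: pm.subspace_0[OF assms(1)])
next
  case (Cons x xs)
  then have "(f x - h x) + ((\<Sum>x\<leftarrow>xs. f x) - (\<Sum>x\<leftarrow>xs. h x)) \<in> H"
    by (intro pm.subspace_add[OF assms(1)]) auto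
  then show ?case by (simp add: algebra_simps)
qed

lemma linear_sum_list: "linear_pm f \<Longrightarrow> f (\<Sum>x\<leftarrow>xs. h x) = (\<Sum>x\<leftarrow>xs. f (h x))"
  by (induction xs) (simp_all add: linear_pmD)

text \<open>The interface between the two halves of the proof: the PBW statement is derived from
  these data, and the free Lie algebra supplies them later. The Lie axioms enter through \<iota>,
  which realises the bracket as a commutator. The retraction \<pi> is a total function with values
  in the carrier, so \<open>F\<close> has no carrier of its own.\<close>

locale primitive_retraction = lie_mod g
  for g :: "(rat, 'a, 'm) module_scheme" (structure) +
  fixes \<iota> :: "'a \<Rightarrow> 'l list \<Rightarrow>\<^sub>0 rat" and \<pi> :: "('l list \<Rightarrow>\<^sub>0 rat) \<Rightarrow> 'a"
  assumes \<iota>_add: "x \<in> carrier g \<Longrightarrow> y \<in> carrier g \<Longrightarrow> \<iota> (x \<oplus> y) = \<iota> x + \<iota> y"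
    and \<iota>_smult: "x \<in> carrier g \<Longrightarrow> \<iota> (c \<odot> x) = c *\<^sub>Q \<iota> x"
    and \<iota>_bracket: "x \<in> carrier g \<Longrightarrow> y \<in> carrier g \<Longrightarrow> \<iota> (x \<otimes> y) = \<iota> x * \<iota> y - \<iota> y * \<iota> x"
    and \<iota>_primitive: "x \<in> carrier g \<Longrightarrow> primitive (\<iota> x)"
    and \<pi>_closed: "\<pi> p \<in> carrier g"
    and \<pi>_add: "\<pi> (p + q) = \<pi> p \<oplus> \<pi> q"
    and \<pi>_smult: "\<pi> (c *\<^sub>Q p) = c \<odot> \<pi> p"
    and \<pi>_one: "\<pi> 1 = \<zero>"
    and \<pi>_\<iota>: "x \<in> carrier g \<Longrightarrow> \<pi> (\<iota> x) = x"
begin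

section \<open>The homomorphism from the enveloping algebra to the free associative algebra\<close>

abbreviation \<iota>prod :: "'a list \<Rightarrow> 'l list \<Rightarrow>\<^sub>0 rat" where
  "\<iota>prod xs \<equiv> prod_list (map \<iota> xs)"

text \<open>The homomorphism U g -> F extending \<iota>, written on representatives.
  \<open>E_cls\<close> and \<open>E_J\<close> say that it descends to the tensor algebra and then to
  the enveloping algebra.\<close>

definition E :: "('a list \<Rightarrow>\<^sub>0 rat) \<Rightarrow> 'l list \<Rightarrow>\<^sub>0 rat" where
  "E = lin \<iota>prod"

lemma linear_E: "linear_pm E"
  unfolding E_def by (rule linear_lin)

lemma E_mult: "E (p * q) = E p * E q"
  unfolding E_def by (rule lin_mult) simp

lemma E_basis [simp]: "E (Poly_Mapping.single xs c) = c *\<^sub>Q \<iota>prod xs"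
  by (simp add: E_def)

lemma E_multilin_rel: "p \<in> multilin_rel g n \<Longrightarrow> E p = 0"
proof -
  have "pm.span (multilin_gens n) \<subseteq> {p. E p \<in> {0}}"
  proof (rule pm.span_minimal)
    show "pm.subspace {p. E p \<in> {0}}"
      by (rule subspace_vimage[OF linear_E pm.subspace_single_0])
    show "multilin_gens n \<subseteq> {p. E p \<in> {0}}"
      by (auto simp: multilin_gens_def words_def linear_pmD[OF linear_E] \<iota>_add \<iota>_smult
          distrib_left distrib_right pscale_mult_left pscale_mult_right)
  qed
  then show "p \<in> multilin_rel g n \<Longrightarrow> E p = 0" by (auto simp: multilin_rel_span)
qed

lemma E_cls:
  assumes "p \<in> W" "q \<in> W" "cls p = cls q"
  shows "E p = E q"
proof -
  have "E (p - q) = E (\<Sum>n\<in>length ` Poly_Mapping.keys (p - q). hcomp n (p - q))"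
    by (simp add: sum_hcomp)
  also have "\<dots> = 0"
    using assms cls_eq_iff by (auto simp: linear_pmD(6)[OF linear_E] intro!: sum.neutral E_multilin_rel)
  finally show ?thesis by (simp add: linear_pmD[OF linear_E])
qed

lemma E_J:
  assumes "cls p \<in> J" "p \<in> W"
  shows "E p = 0"
proof -
  let ?I = "{cls p | p. p \<in> W \<and> E p = 0}"
  have "ideal ?I T"
  proof (rule idealI[OF ring_T])
    have "submodule ?I rat_ring T"
      unfolding submodule_rat_iff[OF rat_module_T]
    proof (intro conjI ballI allI)
      show "?I \<subseteq> carrier T" by (auto intro: cls_closed)
      show "\<zero>\<^bsub>T\<^esub> \<in> ?I" using W_closed linear_pmD[OF linear_E] by (auto simp: cls_zero)
      fix x assume "x \<in> ?I"
      then obtain p where p: "x = cls p" "p \<in> W" "E p = 0" by auto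
      fix c show "c \<odot>\<^bsub>T\<^esub> x \<in> ?I"
        using p by (auto simp: cls_smult intro!: exI[of _ "c *\<^sub>Q p"] W_closed linear_pmD[OF linear_E]
          simp: linear_pmD[OF linear_E])
      fix y assume "y \<in> ?I"
      then obtain q where q: "y = cls q" "q \<in> W" "E q = 0" by auto
      show "x \<oplus>\<^bsub>T\<^esub> y \<in> ?I"
        using p q by (auto simp: cls_add intro!: exI[of _ "p + q"] W_closed simp: linear_pmD[OF linear_E])
    qed
    then show "subgroup ?I (add_monoid T)" by (rule submodule.axioms(1))
  next
    fix a x assume "a \<in> ?I" "x \<in> carrier T"
    then obtain p q where pq: "a = cls p" "p \<in> W" "E p = 0" "x = cls q" "q \<in> W"
      by (auto simp: carrier_T)
    show "x \<otimes>\<^bsub>T\<^esub> a \<in> ?I"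
      using pq by (auto simp: cls_mult E_mult intro!: exI[of _ "q * p"] W_closed)
    show "a \<otimes>\<^bsub>T\<^esub> x \<in> ?I"
      using pq by (auto simp: cls_mult E_mult intro!: exI[of _ "p * q"] W_closed)
  qed
  then have "J \<subseteq> ?I"
  proof (rule J_minimal)
    fix x y assume "x \<in> carrier g" "y \<in> carrier g"
    then show "cls (lie_rel x y) \<in> ?I"
      by (auto intro!: exI[of _ "lie_rel x y"] lie_rel_W
        simp: lie_rel_def[of x y] linear_pmD[OF linear_E] \<iota>_bracket)
  qed
  \<comment> \<open>Membership in \<open>?I\<close> only provides some representative
    \<open>p'\<close> killed by \<open>E\<close>; \<open>E_cls\<close> carries this over to
    \<open>p\<close>.\<close>
  then obtain p' where "p' \<in> W" "E p' = 0" "cls p = cls p'" using assms by auto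
  then show ?thesis using E_cls[of p p'] assms by simp
qed

text \<open>
  \<open>\<Phi> n\<close> is \<open>1 / n!\<close> times the \<open>n\<close>-fold coproduct followed by \<open>\<pi>\<close> in each factor.  Modulo the relations
  of the symmetric power it inverts the map induced by \<open>E\<close> in degree \<open>n\<close> and vanishes on products of fewer
  primitive elements.
\<close>
primrec \<Phi> :: "nat \<Rightarrow> ('l list \<Rightarrow>\<^sub>0 rat) \<Rightarrow> 'a list \<Rightarrow>\<^sub>0 rat" where
  "\<Phi> 0 p = Poly_Mapping.single [] (Poly_Mapping.lookup p [])"
| "\<Phi> (Suc n) p = (1 / of_nat (Suc n)) *\<^sub>Q
     lin (\<lambda>(a, b). basis [\<pi> (basis a)] * \<Phi> n (basis b)) (coprod p)"

lemma linear_\<Phi>: "linear_pm (\<Phi> n)"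
proof (cases n)
  case 0
  show ?thesis unfolding 0
    by (rule linear_pmI) (simp_all add: lookup_add single_add)
next
  case (Suc m)
  show ?thesis unfolding Suc \<Phi>.simps coprod_def by (intro linear_intros)
qed

lemma \<Phi>_W: "\<Phi> n p \<in> W"
proof (induction n arbitrary: p)
  case 0
  show ?case by (simp add: mem_W)
next
  case (Suc n)
  show ?case unfolding \<Phi>.simps
    by (intro W_closed lin_subspace[OF subspace_W])
      (auto intro!: W_closed Suc basis_W \<pi>_closed split: prod.splits)
qed

text \<open>The relations of all symmetric powers together, so that \<open>W\<close> modulo
  \<open>K\<close> is the symmetric algebra. Putting all degrees into one ideal allows congruences
  to be multiplied without tracking degrees.\<close>

definition K :: "('a list \<Rightarrow>\<^sub>0 rat) set" where
  "K = pm.span ((\<Union>n. multilin_rel g n) \<union>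
     {basis xs - basis ys | xs ys. xs \<in> lists (carrier g) \<and> mset xs = mset ys})"

lemma subspace_K: "pm.subspace K"
  unfolding K_def by (rule pm.subspace_span)

lemma multilin_rel_K: "p \<in> multilin_rel g n \<Longrightarrow> p \<in> K"
  unfolding K_def by (rule pm.span_base) auto

lemma perm_K: "xs \<in> lists (carrier g) \<Longrightarrow> mset xs = mset ys \<Longrightarrow> basis xs - basis ys \<in> K"
  unfolding K_def by (rule pm.span_base) auto

lemma K_mult:
  assumes p: "p \<in> K" and q: "q \<in> W"
  shows "q * p \<in> K" "p * q \<in> K"
proof -
  have "K \<subseteq> {p. basis w * p \<in> K} \<inter> {p. p * basis w \<in> K}" if w: "w \<in> lists (carrier g)" for w
  proof -
    have w': "w \<in> words g (length w)" using w by (simp add: words_lists)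
    have "(basis w * p \<in> K) \<and> p * basis w \<in> K"
      if "p \<in> (\<Union>n. multilin_rel g n) \<union>
        {basis xs - basis ys | xs ys. xs \<in> lists (carrier g) \<and> mset xs = mset ys}" for p
      using that
    proof
      assume "p \<in> (\<Union>n. multilin_rel g n)"
      then obtain m where "p \<in> multilin_rel g m" by auto
      then show ?thesis
        using multilin_rel_mult_basis_left[OF _ w'] multilin_rel_mult_basis_right[OF _ w'] multilin_rel_K
        by metis
    next
      assume "p \<in> {basis xs - basis ys | xs ys. xs \<in> lists (carrier g) \<and> mset xs = mset ys}"
      then obtain xs ys where xs: "xs \<in> lists (carrier g)" "mset xs = mset ys" "p = basis xs - basis ys"
        by auto
      then show ?thesis
        using w perm_K[of "w @ xs" "w @ ys"] perm_K[of "xs @ w" "ys @ w"]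
        by (simp add: right_diff_distrib left_diff_distrib mult_single plus_list_def)
    qed
    then have "pm.span ((\<Union>n. multilin_rel g n) \<union>
        {basis xs - basis ys | xs ys. xs \<in> lists (carrier g) \<and> mset xs = mset ys})
        \<subseteq> {p. basis w * p \<in> K} \<inter> {p. p * basis w \<in> K}"
      by (intro pm.span_minimal pm.subspace_inter
          subspace_vimage[OF linear_mult_left[OF linear_id] subspace_K]
          subspace_vimage[OF linear_mult_right[OF linear_id] subspace_K]) blast
    then show ?thesis unfolding K_def[symmetric] .
  qed
  then have *: "basis w * p \<in> K" "p * basis w \<in> K" if "w \<in> lists (carrier g)" for w
    using that p by auto
  show "q * p \<in> K"
    by (rule linear_subspaceI[OF linear_mult_right[OF linear_id] subspace_K])
      (use * q in \<open>auto simp: mem_W\<close>)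
  show "p * q \<in> K"
    by (rule linear_subspaceI[OF linear_mult_left[OF linear_id] subspace_K])
      (use * q in \<open>auto simp: mem_W\<close>)
qed

text \<open>Leads from congruence modulo \<open>K\<close> back to one symmetric power. The
  generators of \<open>K\<close> are homogeneous, so taking the component of length \<open>n\<close>
  either keeps or removes each of them.\<close>

lemma K_sym_rel:
  assumes "p \<in> K"
  shows "tcoset n (hcomp n p) \<in> sym_rel g n"
proof -
  note sub = sym.submod[of n, unfolded submodule_rat_iff[OF rat_module_tensor_power]]
  let ?H = "{p \<in> W. tcoset n (hcomp n p) \<in> sym_rel g n}"
  have "K \<subseteq> ?H" unfolding K_def
  proof (rule pm.span_minimal)
    show "pm.subspace ?H"
    proof (rule pm.subspaceI)
      show "0 \<in> ?H"
        using sub by (simp add: hcomp_simps tcoset_zero tensor_power_simps W_closed)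
      fix p q assume pq: "p \<in> ?H" "q \<in> ?H"
      then have "tcoset n (hcomp n p) \<oplus>\<^bsub>tensor_power g n\<^esub> tcoset n (hcomp n q) \<in> sym_rel g n"
        using sub by blast
      then show "p + q \<in> ?H"
        using pq by (simp add: tensor_power_add hcomp_W hcomp_simps W_closed)
    next
      fix c p assume p: "p \<in> ?H"
      then have "c \<odot>\<^bsub>tensor_power g n\<^esub> tcoset n (hcomp n p) \<in> sym_rel g n"
        using sub by blast
      then show "c *\<^sub>Q p \<in> ?H"
        using p by (simp add: tensor_power_smult hcomp_W hcomp_simps W_closed)
    qed
    show "(\<Union>n. multilin_rel g n) \<union>
      {basis xs - basis ys | xs ys. xs \<in> lists (carrier g) \<and> mset xs = mset ys} \<subseteq> ?H"
    proof (intro Un_least subsetI)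
      fix p assume "p \<in> (\<Union>n. multilin_rel g n)"
      then obtain m where m: "p \<in> multilin_rel g m" by auto
      then have "p \<in> Wn m" using multilin_rel_Wn by auto
      moreover have "tcoset n (hcomp n p) = multilin_rel g n"
        using m hcomp_Wn[OF \<open>p \<in> Wn m\<close>, of n] tcoset_eq_iff[of p n 0] pm.subspace_0[OF subspace_Wn] \<open>p \<in> Wn m\<close>
        by (auto simp: tcoset_zero)
      ultimately show "p \<in> ?H"
        using sub by (simp add: tensor_power_simps Wn_subset)
    next
      fix p assume "p \<in> {basis xs - basis ys | xs ys. xs \<in> lists (carrier g) \<and> mset xs = mset ys}"
      then obtain xs ys where xs: "xs \<in> lists (carrier g)" "mset xs = mset ys" "p = basis xs - basis ys"
        by auto
      then have "length ys = length xs" "set ys = set xs"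
        by (metis size_mset, metis set_mset_mset)
      then have ys: "ys \<in> lists (carrier g)" "length ys = length xs" using xs by auto
      have "p \<in> W" using xs ys by (auto intro!: pm.subspace_diff subspace_W basis_W)
      moreover have "tcoset n (hcomp n p) \<in> sym_rel g n"
      proof (cases "length xs = n")
        case True
        then have "xs \<in> words g n" "ys \<in> words g n" using xs ys by (auto simp: words_def)
        then have "tcoset n p \<in> sym_rel g n"
          unfolding sym_rel_def xs(3) sym_gen_tcoset[symmetric, OF \<open>xs \<in> words g n\<close> \<open>ys \<in> words g n\<close>]
          using xs by (intro subsetD[OF lin_span_superset]) auto
        then show ?thesis using True xs ys by (simp add: hcomp_simps hcomp_single)
      next
        case False
        then show ?thesis using sub xs ys
          by (simp add: hcomp_simps hcomp_single tcoset_zero tensor_power_simps)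
      qed
      ultimately show "p \<in> ?H" by simp
    qed
  qed
  then show ?thesis using assms by auto
qed

text \<open>The assignment of the formal word \<open>[\<pi> p]\<close> to \<open>p\<close> is not
  linear, since [x + y] and [x] + [y] differ as formal combinations. \<open>L\<close> is the linear
  map with the same values on basis words; the two agree modulo \<open>K\<close> by
  \<open>L_K\<close>.\<close>

definition L :: "('l list \<Rightarrow>\<^sub>0 rat) \<Rightarrow> 'a list \<Rightarrow>\<^sub>0 rat" where
  "L = lin (\<lambda>a. basis [\<pi> (basis a)])"

lemma L_W: "L p \<in> W"
  unfolding L_def by (intro lin_subspace[OF subspace_W] basis_W) (simp add: \<pi>_closed)

section \<open>Evaluating the left inverse on products of primitive elements\<close>

lemma add_K: "x \<in> carrier g \<Longrightarrow> y \<in> carrier g \<Longrightarrow> basis [x \<oplus> y] - basis [x] - basis [y] \<in> K"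
  by (rule multilin_rel_K[of _ 1], unfold multilin_rel_span, rule pm.span_base)
    (auto simp: multilin_gens_def words_def intro!: exI[of _ "[]"])

lemma smult_K: "x \<in> carrier g \<Longrightarrow> basis [c \<odot> x] - Poly_Mapping.single [x] c \<in> K"
  by (rule multilin_rel_K[of _ 1], unfold multilin_rel_span, rule pm.span_base)
    (auto simp: multilin_gens_def words_def intro!: exI[of _ "[]"])

lemma L_K: "L p - basis [\<pi> p] \<in> K"
proof -
  have "p \<in> {p. L p - basis [\<pi> p] \<in> K}"
  proof (rule subspaceI_keys)
    show "pm.subspace {p. L p - basis [\<pi> p] \<in> K}"
    proof (rule pm.subspaceI)
      have scale: "c *\<^sub>Q p \<in> {p. L p - basis [\<pi> p] \<in> K}" if "p \<in> {p. L p - basis [\<pi> p] \<in> K}" for c p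
      proof -
        have "c *\<^sub>Q (L p - basis [\<pi> p]) - (basis [c \<odot> \<pi> p] - Poly_Mapping.single [\<pi> p] c) \<in> K"
          by (rule pm.subspace_diff[OF subspace_K pm.subspace_scale[OF subspace_K] smult_K[OF \<pi>_closed]])
            (use that in simp)
        then show ?thesis
          by (simp add: L_def lin_simps \<pi>_smult pm.scale_right_diff_distrib algebra_simps)
      qed
      then show "\<And>c p. p \<in> {p. L p - basis [\<pi> p] \<in> K} \<Longrightarrow> c *\<^sub>Q p \<in> {p. L p - basis [\<pi> p] \<in> K}" .
      \<comment> \<open>The one-letter word [0] is a nonzero formal combination; it is in
        \<open>K\<close> as the homogeneity relation for the scalar 0.\<close>
      have "basis [\<zero>] - Poly_Mapping.single [\<zero>] 0 \<in> K"
        using smult_K[of \<zero> 0] smult_l_null[of \<zero>] by simp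
      moreover have "\<pi> 0 = \<zero>"
        using \<pi>_smult[of 0 1] smult_l_null[of "\<pi> 1"] \<pi>_closed by simp
      ultimately show "0 \<in> {p. L p - basis [\<pi> p] \<in> K}"
        using pm.subspace_neg[OF subspace_K] by (fastforce simp: L_def lin_simps)
      fix p q assume "p \<in> {p. L p - basis [\<pi> p] \<in> K}" "q \<in> {p. L p - basis [\<pi> p] \<in> K}"
      then have "(L p - basis [\<pi> p]) + (L q - basis [\<pi> q]) -
          (basis [\<pi> p \<oplus> \<pi> q] - basis [\<pi> p] - basis [\<pi> q]) \<in> K"
        by (intro pm.subspace_diff[OF subspace_K _ add_K[OF \<pi>_closed \<pi>_closed]] pm.subspace_add[OF subspace_K]) auto
      then show "p + q \<in> {p. L p - basis [\<pi> p] \<in> K}"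
        by (simp add: L_def lin_simps \<pi>_add algebra_simps)
    qed
  qed (simp add: L_def pm.subspace_0[OF subspace_K])
  then show ?thesis by simp
qed

text \<open>Each \<iota> x is primitive and \<open>coprod\<close> is multiplicative, so the
  coproduct of the product is a product of sums \<open>inl (\<iota> x) + inr (\<iota> x)\<close>,
  which \<open>prod_list_add_splits\<close> expands.\<close>

lemma \<Phi>_\<iota>prod_Suc:
  assumes "set xs \<subseteq> carrier g"
  shows "\<Phi> (Suc n) (\<iota>prod xs) =
    (1 / of_nat (Suc n)) *\<^sub>Q (\<Sum>(A, B)\<leftarrow>splits xs. L (\<iota>prod A) * \<Phi> n (\<iota>prod B))"
proof -
  \<comment> \<open>On p \<otimes> q this is the product of \<open>L p\<close> with
    \<open>\<Phi> n q\<close>, that is, the map L \<otimes> \<Phi> followed by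
    concatenation.\<close>
  define M where "M = lin (\<lambda>(a, b). basis [\<pi> (basis a)] * \<Phi> n (basis b))"
  have M: "M (inl p * inr q) = L p * \<Phi> n q" for p q
  proof -
    have "M (inl p * inr q) = lin (\<lambda>a. lin (\<lambda>b. basis [\<pi> (basis a)] * \<Phi> n (basis b)) q) p"
      by (simp add: M_def inl_inr bilin_ext_lin lin_lin)
    also have "\<dots> = lin (\<lambda>a. basis [\<pi> (basis a)] * \<Phi> n q) p"
    proof -
      have "lin (\<lambda>b. r * \<Phi> n (basis b)) q = r * \<Phi> n q" for r
        by (rule linear_eqI[of "lin (\<lambda>b. r * \<Phi> n (basis b))"])
          (auto intro: linear_lin linear_mult_left linear_\<Phi>)
      then show ?thesis by simp
    qed
    also have "\<dots> = L p * \<Phi> n q"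
      unfolding L_def
      by (rule linear_eqI[of "lin (\<lambda>a. basis [\<pi> (basis a)] * \<Phi> n q)"])
        (auto intro: linear_lin linear_mult_right)
    finally show ?thesis .
  qed
  have "coprod (\<iota>prod xs) = prod_list (map (\<lambda>x. inl (\<iota> x) + inr (\<iota> x)) xs)"
    using assms \<iota>_primitive unfolding coprod_prod_list primitive_def map_map comp_def
    by (intro arg_cong[of _ _ prod_list] map_cong) auto
  also have "\<dots> = (\<Sum>(A, B)\<leftarrow>splits xs. inl (\<iota>prod A) * inr (\<iota>prod B))"
    by (subst prod_list_add_splits) (simp_all add: inl_inr inl_prod_list inr_prod_list comp_def)
  finally have "M (coprod (\<iota>prod xs)) = (\<Sum>(A, B)\<leftarrow>splits xs. M (inl (\<iota>prod A) * inr (\<iota>prod B)))"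
    by (simp add: linear_sum_list M_def linear_lin case_prod_unfold)
  then show ?thesis
    by (simp add: M flip: M_def)
qed

text \<open>Induction on \<open>n\<close>, sorting the splits by the number of factors in the first
  place. With none the term vanishes because \<pi> 1 = 0. With two or more, fewer than
  \<open>n\<close> factors are left for the remaining \<open>n\<close> places and the induction
  hypothesis gives 0. With exactly one factor x the term is x times the value on the rest; if the
  length is \<open>Suc n\<close> this is \<open>xs\<close> up to order, and otherwise 0.\<close>

lemma \<Phi>_\<iota>prod:
  assumes "xs \<in> lists (carrier g)" "length xs \<le> n"
  shows "\<Phi> n (\<iota>prod xs) - (if length xs = n then basis xs else 0) \<in> K"
  using assms
proof (induction n arbitrary: xs)
  case 0
  then show ?case by (simp add: pm.subspace_0[OF subspace_K] flip: basis_Nil)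
next
  case (Suc n)
  then have lists_set: "set xs \<subseteq> carrier g" by auto
  let ?b = "if length xs = Suc n then basis xs else 0"
  have "L (\<iota>prod A) * \<Phi> n (\<iota>prod B) - (if length A = 1 then 1 else 0) *\<^sub>Q ?b \<in> K"
    if AB: "(A, B) \<in> set (splits xs)" for A B
  proof -
    have mset: "mset xs = mset A + mset B" using splits_mset[OF AB] .
    then have len: "length xs = length A + length B" by (metis size_mset size_union)
    have set: "set xs = set A \<union> set B" using mset by (metis set_mset_mset set_mset_union)
    then have carr: "A \<in> lists (carrier g)" "B \<in> lists (carrier g)" using Suc.prems by auto
    consider "A = []" | x where "A = [x]" | "length A \<ge> 2"
      by (cases A rule: remdups_adj.cases) auto
    then show ?thesis
    proof cases
      case 1
      \<comment> \<open>Here \<open>B\<close> is all of \<open>xs\<close> and may have length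
        \<open>Suc n\<close>, beyond the induction hypothesis, so the vanishing has to come from the
        first factor.\<close>
      have "L 1 \<in> K"
      proof -
        have "(L 1 - basis [\<zero>]) + (basis [\<zero>] - Poly_Mapping.single [\<zero>] 0) \<in> K"
          using L_K[of 1] smult_K[of \<zero> 0] smult_l_null[of \<zero>]
          by (intro pm.subspace_add[OF subspace_K]) (simp_all add: \<pi>_one)
        then show ?thesis by simp
      qed
      then show ?thesis using 1 K_mult(2)[OF _ \<Phi>_W] by simp
    next
      case (2 x)
      let ?c = "if length B = n then basis B else 0"
      have x: "x \<in> carrier g" using 2 carr by simp
      \<comment> \<open>Three replacements in turn: \<open>L (\<iota> x)\<close> by the letter x,
        then the value on \<open>B\<close> by its prediction \<open>?c\<close>, then
        \<open>x # B\<close> by its rearrangement \<open>xs\<close>.\<close>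
      have "(L (\<iota> x) - basis [x]) * \<Phi> n (\<iota>prod B) + basis [x] * (\<Phi> n (\<iota>prod B) - ?c)
          + (basis [x] * ?c - ?b) \<in> K"
      proof (intro pm.subspace_add[OF subspace_K] K_mult(2)[OF _ \<Phi>_W] K_mult(1)[where q = "basis [x]"])
        show "L (\<iota> x) - basis [x] \<in> K" using L_K[of "\<iota> x"] x by (simp add: \<pi>_\<iota>)
        show "\<Phi> n (\<iota>prod B) - ?c \<in> K" using Suc len 2 carr by simp
        show "basis [x] \<in> W" using x by (intro basis_W) simp
        show "basis [x] * ?c - ?b \<in> K"
          using 2 len mset perm_K[of "x # B" xs] x carr
          by (auto simp: mult_single plus_list_def pm.subspace_0[OF subspace_K])
      qed
      then show ?thesis using 2 by (simp add: algebra_simps)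
    next
      case 3
      then have "\<Phi> n (\<iota>prod B) \<in> K" using Suc.IH[OF carr(2)] len Suc.prems by simp
      then show ?thesis using 3 K_mult(1)[OF _ L_W] by simp
    qed
  qed
  then have "(\<Sum>(A, B)\<leftarrow>splits xs. L (\<iota>prod A) * \<Phi> n (\<iota>prod B)) -
      (\<Sum>(A, B)\<leftarrow>splits xs. (if length A = 1 then 1 else 0) *\<^sub>Q ?b) \<in> K"
    by (intro subspace_sum_list_cong subspace_K) auto
  moreover have "(\<Sum>(A, B)\<leftarrow>splits xs. (if length A = 1 then 1 else 0) *\<^sub>Q ?b) = of_nat (length xs) *\<^sub>Q ?b"
  proof -
    have "(\<Sum>x\<leftarrow>zs. f x *\<^sub>Q v) = (\<Sum>x\<leftarrow>zs. f x) *\<^sub>Q v"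
      for zs :: "('a list \<times> 'a list) list" and f and v :: "'a list \<Rightarrow>\<^sub>0 rat"
      by (induction zs)
        (simp_all only: list.map sum_list.Nil sum_list.Cons pm.scale_zero_left pm.scale_left_distrib)
    then show ?thesis using splits_singleton_count[of xs] by (simp only: case_prod_unfold)
  qed
  ultimately have "(1 / of_nat (Suc n)) *\<^sub>Q ((\<Sum>(A, B)\<leftarrow>splits xs. L (\<iota>prod A) * \<Phi> n (\<iota>prod B)) -
      of_nat (length xs) *\<^sub>Q ?b) \<in> K"
    by (intro pm.subspace_scale[OF subspace_K]) simp
  \<comment> \<open>When \<open>?b\<close> is the word \<open>xs\<close>, the number of singleton
    splits is exactly \<open>Suc n\<close>; otherwise \<open>?b\<close> is 0 and the factor does not
    matter.\<close>
  moreover have "(1 / of_nat (Suc n)) *\<^sub>Q of_nat (length xs) *\<^sub>Q ?b = ?b"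
    by (cases "length xs = Suc n") (simp, simp only: if_False pm.scale_zero_right)
  ultimately show ?case
    by (simp only: pm.scale_right_diff_distrib \<Phi>_\<iota>prod_Suc[OF lists_set])
qed

theorem pbw: "pbw_map g n \<in> lin_iso (sym_power g n) (uea_gr g n)"
proof (rule pbw_criterion)
  fix p q assume p: "p \<in> Wn n" and q: "q \<in> Wf (int n - 1)" and "cls (p - q) \<in> J"
  then have "E (p - q) = 0"
    using p q by (intro E_J) (auto intro: W_closed Wn_subset Wf_W)
  then have eq: "\<Phi> n (E p) = \<Phi> n (E q)" by (simp add: linear_pmD[OF linear_E])
  have "\<Phi> n (E q) \<in> K"
  proof (rule linear_subspaceI[of "\<lambda>q. \<Phi> n (E q)", OF linear_comp[OF linear_\<Phi> linear_E] subspace_K])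
    fix w assume "w \<in> Poly_Mapping.keys q"
    then have "w \<in> lists (carrier g)" "length w < n" using q by (auto simp: Wf_def)
    then show "\<Phi> n (E (basis w)) \<in> K" using \<Phi>_\<iota>prod[of w n] by simp
  qed
  moreover have "\<Phi> n (E p) - p \<in> K"
  proof (rule linear_subspaceI[of "\<lambda>p. \<Phi> n (E p) - p", OF linear_diff[OF linear_comp[OF linear_\<Phi> linear_E] linear_id] subspace_K])
    fix w assume "w \<in> Poly_Mapping.keys p"
    then have "w \<in> lists (carrier g)" "length w = n" using p words_lists[of w n] by (auto simp: mem_Wn)
    then show "\<Phi> n (E (basis w)) - basis w \<in> K" using \<Phi>_\<iota>prod[of w n] by simp
  qed
  ultimately have "\<Phi> n (E q) - (\<Phi> n (E p) - p) \<in> K"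
    by (rule pm.subspace_diff[OF subspace_K])
  then have "p \<in> K" using eq by simp
  then show "tcoset n p \<in> sym_rel g n"
    using K_sym_rel[of p n] hcomp_Wn[OF p, of n] by simp
qed

end

section \<open>The free Lie algebra\<close>

abbreviation nmul :: "('l magma \<Rightarrow>\<^sub>0 rat) \<Rightarrow> ('l magma \<Rightarrow>\<^sub>0 rat) \<Rightarrow> 'l magma \<Rightarrow>\<^sub>0 rat" (infixr \<open>\<bullet>\<close> 70) where
  "p \<bullet> q \<equiv> bilin_ext Br p q"

lemmas nmul_simps = bilin_ext_simps

lemma free_nonassoc_simps [simp]:
  "carrier (free_nonassoc \<Lambda>) = {p. Poly_Mapping.keys p \<subseteq> {t. set_magma t \<subseteq> \<Lambda>}}"
  "\<zero>\<^bsub>free_nonassoc \<Lambda>\<^esub> = 0" "p \<oplus>\<^bsub>free_nonassoc \<Lambda>\<^esub> q = p + q"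
  "c \<odot>\<^bsub>free_nonassoc \<Lambda>\<^esub> p = c *\<^sub>Q p" "p \<otimes>\<^bsub>free_nonassoc \<Lambda>\<^esub> q = p \<bullet> q"
  by (simp_all add: free_nonassoc_def free_mod_def)

primrec brk :: "'l magma \<Rightarrow> 'l list \<Rightarrow>\<^sub>0 rat" where
  "brk (Gen a) = basis [a]"
| "brk (Br s t) = brk s * brk t - brk t * brk s"

lemma lin_brk_nmul: "lin brk (p \<bullet> q) = lin brk p * lin brk q - lin brk q * lin brk p"
proof (rule linear_eqI[of "\<lambda>p. lin brk (p \<bullet> q)"])
  fix s
  show "lin brk (basis s \<bullet> q) = lin brk (basis s) * lin brk q - lin brk q * lin brk (basis s)"
    by (rule linear_eqI[of "\<lambda>q. lin brk (basis s \<bullet> q)"])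
      ((intro linear_intros linear_mult_intros linear_bilin_right)+, simp)
qed (intro linear_intros linear_mult_intros linear_bilin_left)+

lemma primitive_brk: "primitive (brk t)"
  by (induction t) (simp_all add: primitive_commutator, simp add: primitive_def coprod_letter del: lin_single)

primrec leaves :: "'l magma \<Rightarrow> nat" where
  "leaves (Gen a) = 1"
| "leaves (Br s t) = leaves s + leaves t"

lemma leaves_pos: "leaves t > 0"
  by (induction t) auto

text \<open>Homogeneity makes the division by word length in \<open>dyn\<close> a division by one
  number, and with \<open>leaves_pos\<close> it excludes the empty word, as \<open>rnb_mult\<close>
  requires.\<close>

lemma keys_brk: "w \<in> Poly_Mapping.keys (brk t) \<Longrightarrow> length w = leaves t"
proof (induction t arbitrary: w)
  case (Br s t)
  have "w \<in> Poly_Mapping.keys (brk s * brk t) \<union> Poly_Mapping.keys (brk t * brk s)"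
    using Br.prems keys_diff[of "brk s * brk t" "brk t * brk s"] by auto
  then show ?case
    using Br.IH keys_mult[of "brk s" "brk t"] keys_mult[of "brk t" "brk s"]
    by (force simp: plus_list_def)
qed simp

section \<open>The ideal of Lie relations\<close>

context
  fixes \<Lambda> :: "'l set"
begin

abbreviation N where "N \<equiv> carrier (free_nonassoc \<Lambda>)"

lemma subspace_N: "pm.subspace N"
  unfolding free_nonassoc_simps by (rule subspace_keys)

lemma nmul_N: "p \<in> N \<Longrightarrow> q \<in> N \<Longrightarrow> p \<bullet> q \<in> N"
  using keys_bilin_ext[of Br p q] by fastforce

lemmas N_closed = nmul_N pm.subspace_add[OF subspace_N] pm.subspace_diff[OF subspace_N]
  pm.subspace_scale[OF subspace_N] pm.subspace_0[OF subspace_N]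

lemma lie_ideal_N: "p \<in> lie_ideal \<Lambda> \<Longrightarrow> p \<in> N"
  by (induction rule: lie_ideal.induct)
    (auto simp del: free_nonassoc_simps(1) intro: N_closed)

lemma subspace_lie_ideal: "pm.subspace (lie_ideal \<Lambda>)"
  using lie_ideal.smult[of _ \<Lambda>] by (auto intro!: pm.subspaceI lie_ideal.zero lie_ideal.add)

lemma lie_ideal_nmul:
  assumes "u \<in> lie_ideal \<Lambda>" "p \<in> N"
  shows "p \<bullet> u \<in> lie_ideal \<Lambda>" "u \<bullet> p \<in> lie_ideal \<Lambda>"
  using lie_ideal.mult_left[OF assms] lie_ideal.mult_right[OF assms] by simp_all

lemma nmul_anticomm:
  assumes "p \<in> N" "q \<in> N"
  shows "p \<bullet> q + q \<bullet> p \<in> lie_ideal \<Lambda>"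
proof -
  have alt: "r \<bullet> r \<in> lie_ideal \<Lambda>" if "r \<in> N" for r
    using lie_ideal.alternating[OF that] by simp
  have "(p + q) \<bullet> (p + q) - p \<bullet> p - q \<bullet> q \<in> lie_ideal \<Lambda>"
    by (intro pm.subspace_diff[OF subspace_lie_ideal] alt N_closed assms)
  then show ?thesis by (simp add: nmul_simps algebra_simps)
qed

text \<open>The Jacobi identity as ad [p, q] = ad p ad q - ad q ad p. It follows from the cyclic
  form by two uses of anticommutativity: for r and p inside the bracket with q, and for r and
  [p, q].\<close>

lemma nmul_jacobi:
  assumes "p \<in> N" "q \<in> N" "r \<in> N"
  shows "p \<bullet> q \<bullet> r - q \<bullet> p \<bullet> r - (p \<bullet> q) \<bullet> r \<in> lie_ideal \<Lambda>"
proof -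
  have "(p \<bullet> q \<bullet> r + q \<bullet> r \<bullet> p + r \<bullet> p \<bullet> q) - q \<bullet> (r \<bullet> p + p \<bullet> r)
     - (r \<bullet> p \<bullet> q + (p \<bullet> q) \<bullet> r) \<in> lie_ideal \<Lambda>"
    using lie_ideal.jacobi[OF assms]
    by (intro pm.subspace_diff[OF subspace_lie_ideal pm.subspace_diff[OF subspace_lie_ideal]]
      lie_ideal_nmul(1)[OF nmul_anticomm] nmul_anticomm nmul_N assms) simp
  then show ?thesis by (simp add: nmul_simps algebra_simps)
qed

lemma lin_brk_lie_ideal: "p \<in> lie_ideal \<Lambda> \<Longrightarrow> lin brk p = 0"
  by (induction rule: lie_ideal.induct) (simp_all add: lin_simps lin_brk_nmul algebra_simps)

section \<open>The adjoint action and Dynkin's retraction\<close>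

definition act :: "'l list \<Rightarrow> ('l magma \<Rightarrow>\<^sub>0 rat) \<Rightarrow> 'l magma \<Rightarrow>\<^sub>0 rat" where
  "act w q = foldr (\<lambda>a q. if a \<in> \<Lambda> then basis (Gen a) \<bullet> q else 0) w q"

text \<open>
  Modulo \<^const>\<open>lie_ideal\<close> this is the adjoint action of the free associative algebra.  Letters outside \<open>\<Lambda>\<close>
  act as \<open>0\<close>, so that the first argument needs no carrier.
\<close>
definition AD :: "('l list \<Rightarrow>\<^sub>0 rat) \<Rightarrow> ('l magma \<Rightarrow>\<^sub>0 rat) \<Rightarrow> 'l magma \<Rightarrow>\<^sub>0 rat" where
  "AD p q = lin (\<lambda>w. act w q) p"

lemma act_simps: "act [] q = q" "act (a # w) q = (if a \<in> \<Lambda> then basis (Gen a) \<bullet> act w q else 0)"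
  by (simp_all add: act_def)

lemma act_append: "act (u @ v) q = act u (act v q)"
  by (simp add: act_def)

lemma linear_act: "linear_pm (act w)"
  by (induction w; rule linear_pmI) (simp_all add: act_simps linear_pmD nmul_simps)

lemma linear_AD_left: "linear_pm (\<lambda>p. AD p q)"
  unfolding AD_def by (rule linear_lin)

lemma linear_AD_right: "linear_pm (AD p)"
  by (rule linear_pmI) (simp_all add: AD_def linear_pmD[OF linear_act] lin_add_fun lin_pscale_fun)

lemma AD_basis: "AD (basis w) q = act w q"
  by (simp add: AD_def)

lemma AD_mult: "AD (p * p') q = AD p (AD p' q)"
proof (rule linear_eqI[of "\<lambda>p. AD (p * p') q"])
  fix u
  show "AD (basis u * p') q = AD (basis u) (AD p' q)"
    by (rule linear_eqI[of "\<lambda>p'. AD (basis u * p') q"])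
      ((intro linear_comp[OF linear_AD_left] linear_comp[OF linear_AD_right]
         linear_mult_intros linear_id linear_AD_left)+,
       simp add: AD_basis mult_single plus_list_def act_append)
qed (intro linear_comp[OF linear_AD_left] linear_mult_intros linear_id linear_AD_left)+

lemma act_closed:
  assumes "pm.subspace H" "\<And>a q. a \<in> \<Lambda> \<Longrightarrow> q \<in> H \<Longrightarrow> basis (Gen a) \<bullet> q \<in> H" "q \<in> H"
  shows "act w q \<in> H"
  using assms by (induction w) (auto simp: act_simps pm.subspace_0)

lemma AD_N: "q \<in> N \<Longrightarrow> AD p q \<in> N"
  unfolding AD_def by (intro lin_subspace act_closed subspace_N nmul_N) auto

lemma AD_lie_ideal: "q \<in> lie_ideal \<Lambda> \<Longrightarrow> AD p q \<in> lie_ideal \<Lambda>"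
  unfolding AD_def by (intro lin_subspace act_closed subspace_lie_ideal lie_ideal_nmul(1)) auto

text \<open>Acting by the expansion of \<open>s\<close> and bracketing with \<open>s\<close> agree
  on letters, and both turn a bracket into a commutator of operators: the first by
  \<open>AD_mult\<close>, the second by \<open>nmul_jacobi\<close>. The argument \<open>q\<close> is
  arbitrary because the induction hypothesis is applied to results of the action.\<close>

lemma AD_brk:
  assumes "set_magma s \<subseteq> \<Lambda>" "q \<in> N"
  shows "AD (brk s) q - basis s \<bullet> q \<in> lie_ideal \<Lambda>"
  using assms
proof (induction s arbitrary: q)
  case (Gen a)
  then show ?case by (simp add: AD_basis act_simps lie_ideal.zero)
next
  case (Br s t)
  then have st: "basis s \<in> N" "basis t \<in> N" by auto
  have *: "AD (brk s) (AD (brk t) q) - basis s \<bullet> basis t \<bullet> q \<in> lie_ideal \<Lambda>"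
    if "\<And>q. q \<in> N \<Longrightarrow> AD (brk s) q - basis s \<bullet> q \<in> lie_ideal \<Lambda>"
      "\<And>q. q \<in> N \<Longrightarrow> AD (brk t) q - basis t \<bullet> q \<in> lie_ideal \<Lambda>" "basis s \<in> N" for s t
  proof -
    have "(AD (brk s) (AD (brk t) q) - basis s \<bullet> AD (brk t) q) + basis s \<bullet> (AD (brk t) q - basis t \<bullet> q) \<in> lie_ideal \<Lambda>"
      by (intro pm.subspace_add[OF subspace_lie_ideal] lie_ideal_nmul(1) that AD_N Br.prems)
    then show ?thesis by (simp add: nmul_simps)
  qed
  have IH: "AD (brk s) q - basis s \<bullet> q \<in> lie_ideal \<Lambda>" "AD (brk t) q - basis t \<bullet> q \<in> lie_ideal \<Lambda>"
    if "q \<in> N" for q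
    using Br.IH Br.prems(1) that by auto
  have "(AD (brk s) (AD (brk t) q) - basis s \<bullet> basis t \<bullet> q) - (AD (brk t) (AD (brk s) q) - basis t \<bullet> basis s \<bullet> q)
      + (basis s \<bullet> basis t \<bullet> q - basis t \<bullet> basis s \<bullet> q - (basis s \<bullet> basis t) \<bullet> q) \<in> lie_ideal \<Lambda>"
    by (intro pm.subspace_add[OF subspace_lie_ideal] pm.subspace_diff[OF subspace_lie_ideal, OF * *]
        nmul_jacobi st IH Br.prems)
  then show ?case
    by (simp add: linear_pmD(3)[OF linear_AD_left] AD_mult algebra_simps)
qed

text \<open>
  Right-normed bracketing of words.  By the argument of Dynkin, Specht and Wever it multiplies the
  expansion of a Lie monomial of degree \<open>n\<close> by \<open>n\<close>; hence the division in \<open>dyn\<close>, where the empty word causes no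
  trouble because it is sent to \<open>0\<close>.
\<close>
definition rnb :: "'l list \<Rightarrow> 'l magma \<Rightarrow>\<^sub>0 rat" where
  "rnb w = (if w = [] then 0 else act (butlast w) (if last w \<in> \<Lambda> then basis (Gen (last w)) else 0))"

definition dyn :: "('l list \<Rightarrow>\<^sub>0 rat) \<Rightarrow> 'l magma \<Rightarrow>\<^sub>0 rat" where
  "dyn = lin (\<lambda>w. (1 / of_nat (length w)) *\<^sub>Q rnb w)"

lemma rnb_N: "rnb w \<in> N"
  unfolding rnb_def
  by (auto simp del: free_nonassoc_simps(1) intro!: act_closed subspace_N nmul_N N_closed) auto

lemma dyn_N: "dyn p \<in> N"
  unfolding dyn_def by (intro lin_subspace subspace_N N_closed rnb_N)

text \<open>Only the last letter of a word serves as the seed of the bracketing; all letters before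
  it act by \<open>AD\<close>. The last letter must therefore come from \<open>q\<close>, so the
  empty word is excluded from its support.\<close>

lemma rnb_mult:
  assumes "\<And>w. w \<in> Poly_Mapping.keys q \<Longrightarrow> w \<noteq> []"
  shows "lin rnb (p * q) = AD p (lin rnb q)"
proof (rule linear_eqI[of "\<lambda>p. lin rnb (p * q)"])
  fix u
  show "lin rnb (basis u * q) = AD (basis u) (lin rnb q)"
  proof (rule linear_eqI[of "\<lambda>q. lin rnb (basis u * q)"])
    fix v assume "v \<in> Poly_Mapping.keys q"
    then have "v \<noteq> []" using assms by auto
    then show "lin rnb (basis u * basis v) = AD (basis u) (lin rnb (basis v))"
      by (simp add: AD_basis mult_single plus_list_def rnb_def butlast_append act_append)
  qed (intro linear_intros linear_mult_intros linear_comp[OF linear_AD_right])+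
qed (intro linear_intros linear_mult_intros linear_AD_left)+

text \<open>For a bracket of s and t, bracketing the commutator gives, modulo the ideal, deg t
  [s, t] - deg s [t, s]. Anticommutativity makes this (deg s + deg t) [s, t].\<close>

lemma rnb_brk:
  assumes "set_magma t \<subseteq> \<Lambda>"
  shows "lin rnb (brk t) - of_nat (leaves t) *\<^sub>Q basis t \<in> lie_ideal \<Lambda>"
  using assms
proof (induction t)
  case (Gen a)
  then show ?case by (simp add: rnb_def act_simps lie_ideal.zero)
next
  case (Br s t)
  then have st: "basis s \<in> N" "basis t \<in> N" by auto
  have *: "AD (brk s) (lin rnb (brk t)) - of_nat (leaves t) *\<^sub>Q (basis s \<bullet> basis t) \<in> lie_ideal \<Lambda>"
    if "set_magma s \<subseteq> \<Lambda>" "set_magma t \<subseteq> \<Lambda>" "basis t \<in> N"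
      "lin rnb (brk t) - of_nat (leaves t) *\<^sub>Q basis t \<in> lie_ideal \<Lambda>" for s t
  proof -
    have "AD (brk s) (lin rnb (brk t) - of_nat (leaves t) *\<^sub>Q basis t) +
        of_nat (leaves t) *\<^sub>Q (AD (brk s) (basis t) - basis s \<bullet> basis t) \<in> lie_ideal \<Lambda>"
      by (intro pm.subspace_add[OF subspace_lie_ideal] pm.subspace_scale[OF subspace_lie_ideal]
          AD_lie_ideal AD_brk that)
    then show ?thesis
      by (simp only: linear_pmD[OF linear_AD_right] pm.scale_right_diff_distrib) simp
  qed
  have expand: "lin rnb (brk (Br s t)) = AD (brk s) (lin rnb (brk t)) - AD (brk t) (lin rnb (brk s))"
  proof -
    have "w \<noteq> []" if "w \<in> Poly_Mapping.keys (brk r)" for w and r :: "'l magma"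
      using keys_brk[OF that] leaves_pos[of r] by auto
    then show ?thesis by (simp add: lin_simps rnb_mult)
  qed
  let ?s = "of_nat (leaves s) :: rat" and ?t = "of_nat (leaves t) :: rat"
  let ?X = "AD (brk s) (lin rnb (brk t)) - ?t *\<^sub>Q (basis s \<bullet> basis t)"
  let ?Y = "AD (brk t) (lin rnb (brk s)) - ?s *\<^sub>Q (basis t \<bullet> basis s)"
  have "?X \<in> lie_ideal \<Lambda>" "?Y \<in> lie_ideal \<Lambda>"
    by (rule *; use Br st in simp)+
  then have "?X - ?Y - ?s *\<^sub>Q (basis s \<bullet> basis t + basis t \<bullet> basis s) \<in> lie_ideal \<Lambda>"
    by (rule pm.subspace_diff[OF subspace_lie_ideal pm.subspace_diff[OF subspace_lie_ideal]
        pm.subspace_scale[OF subspace_lie_ideal nmul_anticomm[OF st]]])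
  moreover have "basis (Br s t) = basis s \<bullet> basis t" by simp
  then have "lin rnb (brk (Br s t)) - of_nat (leaves (Br s t)) *\<^sub>Q basis (Br s t) =
      ?X - ?Y - ?s *\<^sub>Q (basis s \<bullet> basis t + basis t \<bullet> basis s)"
    by (simp only: expand leaves.simps of_nat_add pm.scale_left_distrib pm.scale_right_distrib algebra_simps)
  ultimately show ?case by (simp only:)
qed

lemma dyn_brk:
  assumes "set_magma t \<subseteq> \<Lambda>"
  shows "dyn (brk t) - basis t \<in> lie_ideal \<Lambda>"
proof -
  have "dyn (brk t) = (1 / of_nat (leaves t)) *\<^sub>Q lin rnb (brk t)"
    unfolding dyn_def
    by (rule linear_eqI[of "lin (\<lambda>w. (1 / of_nat (length w)) *\<^sub>Q rnb w)"]) ((intro linear_intros)+, simp only: lin_single pm.scale_one keys_brk)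
  then have "dyn (brk t) - basis t = (1 / of_nat (leaves t)) *\<^sub>Q (lin rnb (brk t) - of_nat (leaves t) *\<^sub>Q basis t)"
    using leaves_pos[of t] by (simp add: pm.scale_right_diff_distrib)
  then show ?thesis using rnb_brk[OF assms] pm.subspace_scale[OF subspace_lie_ideal] by simp
qed

text \<open>This becomes \<open>\<pi>_\<iota>\<close>. It also yields the converse of
  \<open>lin_brk_lie_ideal\<close> on \<open>N\<close>: if the expansion of \<open>p\<close> is 0,
  then \<open>p\<close> is in the ideal, so the free Lie algebra embeds in the free associative
  algebra.\<close>

lemma dyn_lin_brk:
  assumes "p \<in> N"
  shows "dyn (lin brk p) - p \<in> lie_ideal \<Lambda>"
proof (rule linear_subspaceI[of "\<lambda>p. dyn (lin brk p) - p"])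
  show "linear_pm (\<lambda>p. dyn (lin brk p) - p)"
    unfolding dyn_def by (intro linear_intros)
qed (use assms dyn_brk in \<open>auto intro: subspace_lie_ideal\<close>)

section \<open>The free Lie algebra as a quotient with its retraction\<close>

interpretation nonassoc: rat_submodule "free_nonassoc \<Lambda>" "lie_ideal \<Lambda>"
proof (intro rat_submodule.intro rat_submodule_axioms.intro)
  show M: "rat_module (free_nonassoc \<Lambda>)"
    by (rule rat_moduleI)
      (auto simp del: free_nonassoc_simps(1) simp: add_ac pm.scale_left_distrib pm.scale_right_distrib
        intro: N_closed)
  show "submodule (lie_ideal \<Lambda>) rat_ring (free_nonassoc \<Lambda>)"
    unfolding submodule_rat_iff[OF M]
    using lie_ideal_N subspace_lie_ideal by (auto simp del: free_nonassoc_simps(1) simp: pm.subspace_def)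
qed

abbreviation lc :: "('l magma \<Rightarrow>\<^sub>0 rat) \<Rightarrow> ('l magma \<Rightarrow>\<^sub>0 rat) set" where
  "lc p \<equiv> lie_ideal \<Lambda> +>\<^bsub>free_nonassoc \<Lambda>\<^esub> p"

lemma lc_eq_iff: "p \<in> N \<Longrightarrow> q \<in> N \<Longrightarrow> lc p = lc q \<longleftrightarrow> p - q \<in> lie_ideal \<Lambda>"
  by (simp add: nonassoc.coset_eq_iff rat_module_smult_minus[OF nonassoc.module_axioms] del: free_nonassoc_simps(1))

lemma carrier_free_lie: "carrier (free_lie \<Lambda>) = lc ` N"
  unfolding free_lie_def by (rule nonassoc.quot_simps)

lemma free_lie_add: "p \<in> N \<Longrightarrow> q \<in> N \<Longrightarrow> lc p \<oplus>\<^bsub>free_lie \<Lambda>\<^esub> lc q = lc (p + q)"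
  unfolding free_lie_def by (simp add: nonassoc.quot_add del: free_nonassoc_simps(1))

lemma free_lie_smult: "p \<in> N \<Longrightarrow> c \<odot>\<^bsub>free_lie \<Lambda>\<^esub> lc p = lc (c *\<^sub>Q p)"
  unfolding free_lie_def by (simp add: nonassoc.quot_smult del: free_nonassoc_simps(1))

lemma free_lie_zero: "\<zero>\<^bsub>free_lie \<Lambda>\<^esub> = lc 0"
  unfolding free_lie_def using nonassoc.quot_zero_eq by simp

lemma free_lie_bracket:
  assumes p: "p \<in> N" and q: "q \<in> N"
  shows "lc p \<otimes>\<^bsub>free_lie \<Lambda>\<^esub> lc q = lc (p \<bullet> q)"
proof -
  have eq: "lc (p' \<bullet> q') = lc (p \<bullet> q)" if "p' \<in> lc p" "q' \<in> lc q" for p' q'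
  proof -
    have p': "p' \<in> N" "p' - p \<in> lie_ideal \<Lambda>"
      using that nonassoc.mem_coset_iff[OF p] lc_eq_iff p by blast+
    have q': "q' \<in> N" "q' - q \<in> lie_ideal \<Lambda>"
      using that nonassoc.mem_coset_iff[OF q] lc_eq_iff q by blast+
    have "(p' - p) \<bullet> q' + p \<bullet> (q' - q) \<in> lie_ideal \<Lambda>"
      by (rule pm.subspace_add[OF subspace_lie_ideal lie_ideal_nmul(2) lie_ideal_nmul(1)])
        (fact p p' q')+
    then show ?thesis
      using p q p' q' by (simp add: lc_eq_iff nmul_N nmul_simps del: free_nonassoc_simps(1))
  qed
  have "p \<in> lc p" "q \<in> lc q"
    using p q by (auto simp del: free_nonassoc_simps(1) intro: nonassoc.H.a_rcos_self)
  then have "(\<Union>p'\<in>lc p. \<Union>q'\<in>lc q. lc (p' \<bullet> q')) = lc (p \<bullet> q)"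
    using eq by blast
  then show ?thesis
    by (simp add: free_lie_def quot_mod_def FactRing_def rcoset_mult_def)
qed

definition expand :: "('l magma \<Rightarrow>\<^sub>0 rat) set \<Rightarrow> 'l list \<Rightarrow>\<^sub>0 rat" where
  "expand X = the_elem (lin brk ` X)"

lemma expand_lc:
  assumes p: "p \<in> N"
  shows "expand (lc p) = lin brk p"
proof -
  have "lin brk q = lin brk p" if "q \<in> lc p" for q
  proof -
    have "q \<in> N" "lc q = lc p"
      using that nonassoc.mem_coset_iff[OF p, of q] by blast+
    then have "q - p \<in> lie_ideal \<Lambda>" using lc_eq_iff p by blast
    then show ?thesis using lin_brk_lie_ideal by (fastforce simp: lin_simps)
  qed
  moreover have "p \<in> lc p" using p by (rule nonassoc.H.a_rcos_self)
  ultimately have "lin brk ` lc p = {lin brk p}" by blast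
  then show ?thesis by (simp add: expand_def)
qed

lemma primitive_retraction_free_lie: "primitive_retraction (free_lie \<Lambda>) expand (\<lambda>p. lc (dyn p))"
proof (intro primitive_retraction.intro lie_mod.intro rat_mod.intro lie_mod_axioms.intro
    primitive_retraction_axioms.intro)
  show "rat_module (free_lie \<Lambda>)" unfolding free_lie_def by (rule nonassoc.rat_module_quot)
  fix p q :: "'l list \<Rightarrow>\<^sub>0 rat" and c
  show "lc (dyn p) \<in> carrier (free_lie \<Lambda>)" by (simp only: carrier_free_lie imageI dyn_N)
  show "lc (dyn (p + q)) = lc (dyn p) \<oplus>\<^bsub>free_lie \<Lambda>\<^esub> lc (dyn q)"
    by (simp only: free_lie_add dyn_N) (simp add: dyn_def lin_simps)
  show "lc (dyn (c *\<^sub>Q p)) = c \<odot>\<^bsub>free_lie \<Lambda>\<^esub> lc (dyn p)"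
    by (simp only: free_lie_smult dyn_N) (simp add: dyn_def lin_simps)
  show "lc (dyn 1) = \<zero>\<^bsub>free_lie \<Lambda>\<^esub>"
    by (simp add: free_lie_zero dyn_def lin_one rnb_def)
next
  fix x assume "x \<in> carrier (free_lie \<Lambda>)"
  then obtain p where p: "p \<in> N" "x = lc p" by (auto simp only: carrier_free_lie)
  have "lin brk p \<in> {p. primitive p}"
    by (intro lin_subspace subspace_primitive) (simp add: primitive_brk)
  then show "primitive (expand x)"
    using p by (simp only: expand_lc mem_Collect_eq)
  show "lc (dyn (expand x)) = x"
    using p dyn_lin_brk dyn_N lc_eq_iff by (simp only: expand_lc)
  show "expand (c \<odot>\<^bsub>free_lie \<Lambda>\<^esub> x) = c *\<^sub>Q expand x" for c
    using p by (simp only: free_lie_smult expand_lc N_closed lin_simps)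
  fix y assume "y \<in> carrier (free_lie \<Lambda>)"
  then obtain q where q: "q \<in> N" "y = lc q" by (auto simp only: carrier_free_lie)
  show "x \<otimes>\<^bsub>free_lie \<Lambda>\<^esub> y \<in> carrier (free_lie \<Lambda>)"
    using p q by (simp only: free_lie_bracket carrier_free_lie imageI nmul_N)
  show "expand (x \<oplus>\<^bsub>free_lie \<Lambda>\<^esub> y) = expand x + expand y"
    using p q by (simp only: free_lie_add expand_lc N_closed lin_simps)
  show "expand (x \<otimes>\<^bsub>free_lie \<Lambda>\<^esub> y) = expand x * expand y - expand y * expand x"
    using p q by (simp only: free_lie_bracket expand_lc N_closed lin_brk_nmul)
qed

end

theorem proposition3p2:
  fixes \<Lambda> :: "'l set" and n :: nat
  shows "pbw_map (free_lie \<Lambda>) n \<in>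
           lin_iso (sym_power (free_lie \<Lambda>) n) (uea_gr (free_lie \<Lambda>) n)"
  by (rule primitive_retraction.pbw[OF primitive_retraction_free_lie])

end
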